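(* Let $\Delta:V\to V\otimes V$ and $\phi:V\to\tilde V\otimes V$ be the linear maps $$\Delta(t,s)=\sum_{c\in\mathrm{Adm}(s)}\big(t,P^c(s)\big)\otimes\big(R^c(t),R^c(s)\big),\qquad \phi(t,s)=\sum_{s'\subseteq s}(t,s')\otimes(t/s',s/s'),$$ and let $\xi:\tilde V\otimes\tilde V\otimes V\to\tilde V\otimes V$ be the linear map defined on basis elements by: (1) $\xi\big((t',s')\otimes(t'',s'')\otimes(u,v)\big)=(t',s'\cup s'')\otimes\big(t'/(s'\cup s''),\bar v\big)$ if $t''=R^c(t')$, $u=t'/s'$ and $v=P^{\tilde c}(t'/s')$, where $c$ is an admissible cut of $t'$ and $\tilde c$ is an admissible cut of $t'$ which does not meet $s'$ and $s''$; here $\bar v=P^{\tilde c}\big(t'/(s'\cup s'')\big)$ is $v$ viewed in $t'/(s'\cup s'')$; (2) $\xi\big((t',s')\otimes(t'',s'')\otimes(u,v)\big)=0$ if the conditions of item (1) are not matched. Then $$(\mathrm{id}\otimes\Delta)\circ\phi=(\xi\otimes\mathrm{id})\circ\tau^{23}\circ(\phi\otimes\phi)\circ\Delta$$ as maps $V\to\tilde V\otimes V\otimes V$, where $\tau^{23}:\tilde V\otimes V\otimes\tilde V\otimes V\to\tilde V\otimes\tilde V\otimes V\otimes V$ exchanges the second and third tensor factors.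
   Context: Work over a fixed base field. A rooted tree is a finite connected simply connected oriented graph in which every vertex has exactly one incoming edge, except a distinguished vertex (the root) which has none; a forest is a finite (possibly empty) disjoint union of rooted trees; $\mathbf 1$ denotes the empty forest. Admissible cuts: an admissible cut $c$ of a rooted tree $t$ is a (possibly empty) set of edges such that every path from the root to a leaf contains at most one edge of $c$; in addition one allows the total cut. The pruning $P^c(t)$ is the subforest of $t$ lying above the cut and the trunk $R^c(t)$ is the subtree of $t$ lying below it. For the empty cut $P^c(t)=\mathbf 1$, $R^c(t)=t$; for the total cut $P^c(t)=t$, $R^c(t)=\mathbf 1$. An admissible cut of a forest is a choice of an admissible cut (possibly empty or total) of each component. $\mathrm{Adm}$ denotes the set of all admissible cuts (including empty and total ones). If $s=P^{c_0}(t)$ and $c\in\mathrm{Adm}(s)$, then $P^c(s)$ is also a pruning of $t$, and $R^c(t)$ denotes the corresponding trunk, i.e. the subtree of $t$ on the vertices not in $P^c(s)$. A subforest $s$ of a tree (or forest) $t$ is a (possibly empty) collection of pairwise vertex-disjoint subtrees of $t$; it is a covering subforest of $t$ if every vertex of $t$ belongs to one of them (single-vertex subtrees are allowed). In the sum defining $\phi$, $s'\subseteq s$ runs over the covering subforests of $s$. $t/s'$ is obtained from $t$ by contracting each connected component of $s'$ onto a vertex; similarly $s/s'$, regarded as a subforest of $t/s'$. $V$ (resp. $\tilde V$) is the vector space with basis the couples $(t,s)$ with $t$ a rooted tree and $s=P^{c}(t)$ for some admissible cut $c$ of $t$ (resp. $s$ any subforest of $t$); the couple $(\mathbf 1,\mathbf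 1)$ is allowed. One has $\Delta(V)\subset V\otimes V$ and $\phi(V)\subset\tilde V\otimes V$. Trees are regarded as actual graphs (taken from a fixed set of trees closed under subtrees and contraction) and $s$ as an actual subgraph of $t$; edges of $t/s$ are identified with edges of $t$ not in $s$, and equalities such as $t''=R^c(t')$ and $u=t'/s'$ mean equality with the indicated trunk or contracted tree. For subforests $s'$ of $t'$ and $s''$ of $R^c(t')\subseteq t'$, $s'\cup s''$ is their union inside $t'$. A cut $\tilde c$ of $t'$ does not meet a subforest if it contains no edge of that subforest; an admissible cut of $t'$ not meeting $s'$ and $s''$ is also viewed as an admissible cut of $t'/s'$ and of $t'/(s'\cup s'')$ (the empty and total cuts corresponding to the empty and total cuts). *)

theory Defs
  imports
    "HOL-Library.Poly_Mapping"
    "HOL-Library.FuncSet"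
    "HOL-Library.Disjoint_Sets"
    "Graph_Theory.Graph_Theory"
begin

section \<open>Rooted trees, subforests, contraction\<close>

text \<open>
  Graphs are loop-free digraphs without parallel edges, so an edge is the pair of its end points
  and equality of graphs is literal equality of vertex and edge sets. Edges point away from the
  root.
\<close>

type_synonym 'a graph = "'a pair_pre_digraph"

definition empty_forest :: "'a graph" (\<open>\<one>\<^sub>F\<close>) where
  "\<one>\<^sub>F = \<lparr>pverts = {}, parcs = {}\<rparr>"

definition graph_Union :: "'a graph set \<Rightarrow> 'a graph" where
  "graph_Union T = \<lparr>pverts = (\<Union>t\<in>T. pverts t), parcs = (\<Union>t\<in>T. parcs t)\<rparr>"

definition induced :: "'a graph \<Rightarrow> 'a set \<Rightarrow> 'a graph" where
  "induced t W = \<lparr>pverts = W, parcs = {e \<in> parcs t. fst e \<in> W \<and> snd e \<in> W}\<rparr>"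

definition is_root :: "'a graph \<Rightarrow> 'a \<Rightarrow> bool" where
  "is_root t r \<longleftrightarrow> r \<in> pverts t \<and> in_degree (with_proj t) r = 0
     \<and> (\<forall>v \<in> pverts t - {r}. in_degree (with_proj t) v = 1)"

definition is_leaf :: "'a graph \<Rightarrow> 'a \<Rightarrow> bool" where
  "is_leaf t l \<longleftrightarrow> l \<in> pverts t \<and> out_degree (with_proj t) l = 0"

text \<open>
  In the symmetrised graph every edge gives rise to a closed walk of length 2; a cycle of the
  underlying undirected graph is therefore a cycle of length at least 3 there.
\<close>

definition simply_connected :: "'a graph \<Rightarrow> bool" where
  "simply_connected t \<longleftrightarrow> (\<forall>p. pre_digraph.cycle (with_proj (mk_symmetric (with_proj t))) p \<longrightarrow> length p \<le> 2)"

definition rooted_tree :: "'a graph \<Rightarrow> bool" where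
  "rooted_tree t \<longleftrightarrow> pair_digraph t \<and> (\<forall>(u, v) \<in> parcs t. (v, u) \<notin> parcs t)
     \<and> Digraph_Component.connected (with_proj t) \<and> simply_connected t \<and> (\<exists>r. is_root t r)"

text \<open>
  A collection of disjoint trees is identified with its union, from which it is recovered as the
  set of connected components. The vertex set of a subforest is part of the data, so subforests
  differing by single-vertex trees are different.
\<close>

definition subforest :: "'a graph \<Rightarrow> 'a graph \<Rightarrow> bool" where
  "subforest s t \<longleftrightarrow> (\<exists>T. (\<forall>u \<in> T. rooted_tree u \<and> subgraph (with_proj u) (with_proj t))
     \<and> disjoint_family_on pverts T \<and> s = graph_Union T)"

definition covering_subforest :: "'a graph \<Rightarrow> 'a graph \<Rightarrow> bool" where
  "covering_subforest s t \<longleftrightarrow> subforest s t \<and> pverts t \<subseteq> pverts s"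

definition components :: "'a graph \<Rightarrow> 'a graph set" where
  "components s = {C. pre_digraph.max_subgraph (with_proj s) Digraph_Component.connected (with_proj C)}"

text \<open>
  The vertex onto which a component of \<open>s\<close> is contracted is taken to be the root of that component;
  vertices outside \<open>s\<close> are kept. Thus the contracted tree lives on a subset of the vertices of \<open>t\<close>,
  and an edge \<open>(u, v)\<close> of \<open>t\<close> not in \<open>s\<close> is identified with the edge
  \<open>(contract_vertex s u, contract_vertex s v)\<close> of the contracted tree.
\<close>

definition contract_vertex :: "'a graph \<Rightarrow> 'a \<Rightarrow> 'a" where
  "contract_vertex s v =
     (if v \<in> pverts s then THE r. \<exists>C \<in> components s. v \<in> pverts C \<and> is_root C r else v)"

definition contract_edge :: "'a graph \<Rightarrow> 'a \<times> 'a \<Rightarrow> 'a \<times> 'a" where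
  "contract_edge s = map_prod (contract_vertex s) (contract_vertex s)"

definition contract :: "'a graph \<Rightarrow> 'a graph \<Rightarrow> 'a graph" (infixl \<open>\<oslash>\<close> 70) where
  "t \<oslash> s = \<lparr>pverts = contract_vertex s ` pverts t, parcs = contract_edge s ` (parcs t - parcs s)\<rparr>"

section \<open>Admissible cuts\<close>

datatype 'a cut = Total | Edges "('a \<times> 'a) set"

text \<open>
  The following four notions are also applied to the empty tree, where the total and the empty cut
  have the same (empty) pruning and trunk.
\<close>

definition tree_cuts :: "'a graph \<Rightarrow> 'a cut set" where
  "tree_cuts t = insert Total {Edges c | c. c \<subseteq> parcs t
     \<and> (\<forall>r l p. is_root t r \<and> is_leaf t l \<and> pre_digraph.apath (with_proj t) r p l
          \<longrightarrow> card (set p \<inter> c) \<le> 1)}"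

fun tree_pruning :: "'a cut \<Rightarrow> 'a graph \<Rightarrow> 'a graph" where
  "tree_pruning Total t = t"
| "tree_pruning (Edges c) t = induced t {v \<in> pverts t.
     \<exists>r p. is_root t r \<and> pre_digraph.apath (with_proj t) r p v \<and> set p \<inter> c \<noteq> {}}"

definition trunk_of :: "'a graph \<Rightarrow> 'a graph \<Rightarrow> 'a graph" where
  "trunk_of t p = induced t (pverts t - pverts p)"

definition tree_trunk :: "'a cut \<Rightarrow> 'a graph \<Rightarrow> 'a graph" where
  "tree_trunk c t = trunk_of t (tree_pruning c t)"

text \<open>A cut of a forest is a choice of a cut of each component.\<close>

definition Adm :: "'a graph \<Rightarrow> ('a graph \<Rightarrow> 'a cut) set" where
  "Adm s = (\<Pi>\<^sub>E C \<in> components s. tree_cuts C)"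

definition pruning :: "('a graph \<Rightarrow> 'a cut) \<Rightarrow> 'a graph \<Rightarrow> 'a graph" where
  "pruning c s = graph_Union ((\<lambda>C. tree_pruning (c C) C) ` components s)"

definition trunk :: "('a graph \<Rightarrow> 'a cut) \<Rightarrow> 'a graph \<Rightarrow> 'a graph" where
  "trunk c s = graph_Union ((\<lambda>C. tree_trunk (c C) C) ` components s)"

fun avoids :: "'a cut \<Rightarrow> 'a graph \<Rightarrow> bool" where
  "avoids Total s \<longleftrightarrow> True"
| "avoids (Edges c) s \<longleftrightarrow> c \<inter> parcs s = {}"

text \<open>A cut of \<open>t\<close> avoiding \<open>s\<close>, viewed as a cut of \<open>t \<oslash> s\<close>.\<close>

fun contract_cut :: "'a graph \<Rightarrow> 'a cut \<Rightarrow> 'a cut" where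
  "contract_cut s Total = Total"
| "contract_cut s (Edges c) = Edges (contract_edge s ` c)"

section \<open>Vector spaces with a basis\<close>

text \<open>
  \<open>'b \<Rightarrow>\<^sub>0 'k\<close> is the \<open>'k\<close>-vector space with basis \<open>'b\<close>. The tensor product of the spaces with
  bases \<open>'b\<close> and \<open>'c\<close> is the space with basis \<open>'b \<times> 'c\<close>.
\<close>

definition scale :: "'k \<Rightarrow> ('b \<Rightarrow>\<^sub>0 'k::field) \<Rightarrow> ('b \<Rightarrow>\<^sub>0 'k)" where
  "scale a x = Poly_Mapping.map ((*) a) x"

definition basis_vector :: "'b \<Rightarrow> ('b \<Rightarrow>\<^sub>0 'k::field)" where
  "basis_vector b = Poly_Mapping.single b 1"

definition space_on :: "'b set \<Rightarrow> ('b \<Rightarrow>\<^sub>0 'k::field) set" where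
  "space_on B = {x. Poly_Mapping.keys x \<subseteq> B}"

definition linear_extension :: "('b \<Rightarrow> ('c \<Rightarrow>\<^sub>0 'k)) \<Rightarrow> ('b \<Rightarrow>\<^sub>0 'k::field) \<Rightarrow> ('c \<Rightarrow>\<^sub>0 'k)" where
  "linear_extension f x = (\<Sum>b \<in> Poly_Mapping.keys x. scale (Poly_Mapping.lookup x b) (f b))"

definition tensor :: "('b \<Rightarrow>\<^sub>0 'k) \<Rightarrow> ('c \<Rightarrow>\<^sub>0 'k) \<Rightarrow> ('b \<times> 'c \<Rightarrow>\<^sub>0 'k::field)" where
  "tensor x y = (\<Sum>b \<in> Poly_Mapping.keys x. \<Sum>c \<in> Poly_Mapping.keys y.
     Poly_Mapping.single (b, c) (Poly_Mapping.lookup x b * Poly_Mapping.lookup y c))"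

definition tensor_map ::
  "(('b \<Rightarrow>\<^sub>0 'k) \<Rightarrow> ('d \<Rightarrow>\<^sub>0 'k)) \<Rightarrow> (('c \<Rightarrow>\<^sub>0 'k) \<Rightarrow> ('e \<Rightarrow>\<^sub>0 'k)) \<Rightarrow>
   ('b \<times> 'c \<Rightarrow>\<^sub>0 'k) \<Rightarrow> ('d \<times> 'e \<Rightarrow>\<^sub>0 'k::field)" (infixr \<open>\<otimes>\<^sub>m\<close> 75) where
  "f \<otimes>\<^sub>m g = linear_extension (\<lambda>(b, c). tensor (f (basis_vector b)) (g (basis_vector c)))"

text \<open>The canonical isomorphism \<open>(X \<otimes> Y) \<otimes> Z \<longrightarrow> X \<otimes> (Y \<otimes> Z)\<close>.\<close>

definition assoc :: "(('a \<times> 'b) \<times> 'c \<Rightarrow>\<^sub>0 'k) \<Rightarrow> ('a \<times> 'b \<times> 'c \<Rightarrow>\<^sub>0 'k::field)" where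
  "assoc = linear_extension (\<lambda>((a, b), c). basis_vector (a, b, c))"

text \<open>Exchange of the second and third of four factors, bracketed for applying \<open>\<xi> \<otimes>\<^sub>m id\<close> next.\<close>

definition tau23 :: "(('a \<times> 'b) \<times> ('c \<times> 'd) \<Rightarrow>\<^sub>0 'k) \<Rightarrow> (('a \<times> 'c \<times> 'b) \<times> 'd \<Rightarrow>\<^sub>0 'k::field)"
    (\<open>\<tau>\<^sub>2\<^sub>3\<close>) where
  "\<tau>\<^sub>2\<^sub>3 = linear_extension (\<lambda>((a, b), (c, d)). basis_vector ((a, c, b), d))"

lemma lookup_scale [simp]: "Poly_Mapping.lookup (scale a x) b = a * Poly_Mapping.lookup x b"
  by (simp add: scale_def Poly_Mapping.map.rep_eq when_def)

lemma vector_space_scale: "vector_space (scale :: 'k \<Rightarrow> ('b \<Rightarrow>\<^sub>0 'k::field) \<Rightarrow> _)"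
  by unfold_locales (auto intro!: poly_mapping_eqI simp: lookup_add algebra_simps)

lemma linear_extension_superset:
  assumes "finite A" "Poly_Mapping.keys x \<subseteq> A"
  shows "linear_extension f x = (\<Sum>b \<in> A. scale (Poly_Mapping.lookup x b) (f b))"
  unfolding linear_extension_def
  using assms by (intro sum.mono_neutral_left)
    (auto intro!: poly_mapping_eqI simp: in_keys_iff)

lemma linear_linear_extension:
  fixes f :: "'b \<Rightarrow> ('c \<Rightarrow>\<^sub>0 'k::field)"
  shows "Vector_Spaces.linear scale scale (linear_extension f)"
proof -
  interpret B: vector_space "scale :: 'k \<Rightarrow> ('b \<Rightarrow>\<^sub>0 'k) \<Rightarrow> _" by (rule vector_space_scale)
  interpret C: vector_space "scale :: 'k \<Rightarrow> ('c \<Rightarrow>\<^sub>0 'k) \<Rightarrow> _" by (rule vector_space_scale)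
  have 1: "linear_extension f (x + y) = linear_extension f x + linear_extension f y" for x y
  proof -
    let ?A = "Poly_Mapping.keys x \<union> Poly_Mapping.keys y"
    have "Poly_Mapping.keys (x + y) \<subseteq> ?A" by (rule Poly_Mapping.keys_add)
    then show ?thesis
      by (simp add: linear_extension_superset[of ?A] lookup_add C.scale_left_distrib sum.distrib)
  qed
  have 2: "linear_extension f (scale a x) = scale a (linear_extension f x)" for a x
  proof -
    have "Poly_Mapping.keys (scale a x) \<subseteq> Poly_Mapping.keys x"
      by (auto simp: in_keys_iff)
    then show ?thesis
      by (simp add: linear_extension_superset[of "Poly_Mapping.keys x"] C.scale_sum_right)
  qed
  show ?thesis by unfold_locales (simp_all add: 1 2)
qed

lemma linear_extension_basis_vector [simp]: "linear_extension f (basis_vector b) = f b"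
  by (auto intro!: poly_mapping_eqI simp: linear_extension_def basis_vector_def)

lemma tensor_basis_vector [simp]:
  "tensor (basis_vector b) (basis_vector c) = basis_vector (b, c)"
  by (simp add: tensor_def basis_vector_def)

section \<open>The spaces and the maps\<close>

type_synonym 'a couple = "'a graph \<times> 'a graph"

definition V_basis :: "'a couple set" where
  "V_basis = {(t, s). rooted_tree t \<and> (\<exists>c \<in> tree_cuts t. s = tree_pruning c t)} \<union> {(\<one>\<^sub>F, \<one>\<^sub>F)}"

definition Vtilde_basis :: "'a couple set" where
  "Vtilde_basis = {(t, s). rooted_tree t \<and> subforest s t} \<union> {(\<one>\<^sub>F, \<one>\<^sub>F)}"

text \<open>
  The maps below are given by their values on basis elements; the formulas make sense for all
  couples, and only their restrictions to the subspaces spanned by \<open>V_basis\<close>, \<open>Vtilde_basis\<close> and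
  products of these matter.
\<close>

definition V :: "('a couple \<Rightarrow>\<^sub>0 'k::field) set" where
  "V = space_on V_basis"

definition Delta :: "('a couple \<Rightarrow>\<^sub>0 'k) \<Rightarrow> ('a couple \<times> 'a couple \<Rightarrow>\<^sub>0 'k::field)" (\<open>\<Delta>\<close>) where
  "\<Delta> = linear_extension (\<lambda>(t, s). \<Sum>c \<in> Adm s.
     basis_vector ((t, pruning c s), (trunk_of t (pruning c s), trunk c s)))"

definition phi :: "('a couple \<Rightarrow>\<^sub>0 'k) \<Rightarrow> ('a couple \<times> 'a couple \<Rightarrow>\<^sub>0 'k::field)" (\<open>\<phi>\<close>) where
  "\<phi> = linear_extension (\<lambda>(t, s). \<Sum>s' \<in> {s'. covering_subforest s' s}.
     basis_vector ((t, s'), (t \<oslash> s', s \<oslash> s')))"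

definition xi_pruning ::
  "'a couple \<Rightarrow> 'a couple \<Rightarrow> 'a couple \<Rightarrow> 'a graph \<Rightarrow> bool" where
  "xi_pruning = (\<lambda>(t', s') (t'', s'') (u, v) w.
     (\<exists>c \<in> tree_cuts t'. t'' = tree_trunk c t') \<and> u = t' \<oslash> s' \<and>
     (\<exists>c \<in> tree_cuts t'. avoids c s' \<and> avoids c s'' \<and>
        v = tree_pruning (contract_cut s' c) (t' \<oslash> s') \<and>
        w = tree_pruning (contract_cut (graph_Union {s', s''}) c) (t' \<oslash> graph_Union {s', s''})))"

text \<open>
  On \<open>Vtilde_basis \<times> Vtilde_basis \<times> V_basis\<close> the graph \<open>w\<close> is unique if it exists: the cut is determined by its
  pruning \<open>v\<close> up to the coincidence of the empty and the total cut of the empty tree.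
\<close>

definition xi :: "('a couple \<times> 'a couple \<times> 'a couple \<Rightarrow>\<^sub>0 'k) \<Rightarrow> ('a couple \<times> 'a couple \<Rightarrow>\<^sub>0 'k::field)"
    (\<open>\<xi>\<close>) where
  "\<xi> = linear_extension (\<lambda>((t', s'), (t'', s''), (u, v)).
     if \<exists>w. xi_pruning (t', s') (t'', s'') (u, v) w
     then basis_vector ((t', graph_Union {s', s''}),
            (t' \<oslash> graph_Union {s', s''}, THE w. xi_pruning (t', s') (t'', s'') (u, v) w))
     else 0)"

text \<open>The index sets of the sums defining \<open>\<Delta>\<close> and \<open>\<phi>\<close> are finite.\<close>

lemma finite_subgraphs:
  assumes "finite (pverts s)" "finite (parcs s)"
  shows "finite {C :: 'a graph. pverts C \<subseteq> pverts s \<and> parcs C \<subseteq> parcs s}"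
proof (rule finite_subset)
  show "{C :: 'a graph. pverts C \<subseteq> pverts s \<and> parcs C \<subseteq> parcs s}
      \<subseteq> (\<lambda>(A, B). \<lparr>pverts = A, parcs = B\<rparr>) ` (Pow (pverts s) \<times> Pow (parcs s))"
  proof
    fix C :: "'a graph" assume "C \<in> {C. pverts C \<subseteq> pverts s \<and> parcs C \<subseteq> parcs s}"
    then show "C \<in> (\<lambda>(A, B). \<lparr>pverts = A, parcs = B\<rparr>) ` (Pow (pverts s) \<times> Pow (parcs s))"
      by (intro image_eqI[where x = "(pverts C, parcs C)"]) auto
  qed
qed (use assms in auto)

lemma finite_covering_subforests:
  assumes "finite (pverts s)" "finite (parcs s)"
  shows "finite {s'. covering_subforest s' s}"
  by (rule finite_subset[OF _ finite_subgraphs[OF assms]])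
    (fastforce simp: covering_subforest_def subforest_def subgraph_def graph_Union_def)

lemma finite_Adm:
  assumes "finite (pverts s)" "finite (parcs s)"
  shows "finite (Adm s)"
proof -
  have sub: "pverts C \<subseteq> pverts s \<and> parcs C \<subseteq> parcs s" if "C \<in> components s" for C
    using that by (auto simp: components_def pre_digraph.max_subgraph_def subgraph_def)
  have "finite (components s)"
    by (rule finite_subset[OF _ finite_subgraphs[OF assms]]) (use sub in auto)
  moreover have "finite (tree_cuts C)" if "C \<in> components s" for C
  proof -
    have "finite (Pow (parcs C))" using sub[OF that] assms by (auto intro: finite_subset)
    then have "finite (insert Total (Edges ` Pow (parcs C)))" by blast
    then show ?thesis by (rule rev_finite_subset) (auto simp: tree_cuts_def)
  qed
  ultimately show ?thesis unfolding Adm_def by (rule finite_PiE)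
qed

end

theory Submission
  imports Defs
begin

text \<open>
Let \<open>s = P\<^sup>c(t)\<close>. A cut of a forest amounts to the set \<open>U\<close> of vertices that it prunes off, and \<open>U\<close> can be any
set of vertices closed under passing from the tail to the head of an edge; call these sets upsets. A
covering subforest of \<open>s\<close> amounts to its set \<open>B\<close> of edges, and \<open>B\<close> can be any set of edges of \<open>s\<close>.
Writing \<open>W\<close> for the vertex set of \<open>s\<close>, the left hand side of the identity is therefore a sum over the pairs
\<open>(B, X)\<close> with \<open>X\<close> an upset of the contraction \<open>s / B\<close>, and the right hand side a sum over the triples
\<open>(U, a, b)\<close> with \<open>U \<subseteq> W\<close> an upset, \<open>a\<close> a set of edges of \<open>s\<close> inside \<open>U\<close> and \<open>b\<close> one inside \<open>W - U\<close>.

Contract every component of \<open>B\<close> onto its root. The upsets \<open>X\<close> of the contraction correspond to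
those upsets \<open>U\<close> of \<open>s\<close> that are unions of fibres of the contraction, that is, for which no edge of \<open>B\<close>
joins \<open>U\<close> to its complement: \<open>U\<close> is the preimage of \<open>X\<close>, and \<open>X\<close> consists of the vertices of \<open>U\<close> that survive.
For such a \<open>U\<close> the set \<open>B\<close> splits uniquely as \<open>a \<union> b\<close>. This is the bijection
\<open>(B, X) \<leftrightarrow> (U, a, b)\<close> of \<open>sum_contract_then_cut\<close>. Corresponding summands agree because
contracting \<open>B\<close> commutes with restricting the graph to a union of fibres
(\<open>contract_arcs_induced\<close>), applied to \<open>W\<close>, to \<open>U\<close>, to its complement, and to \<open>W - U\<close>.

The value of \<open>\<xi>\<close> on the summand of \<open>(U, a, b)\<close> is the expected one (\<open>xi_value\<close>): a cut
avoiding \<open>a\<close> prunes \<open>t / a\<close> at the surviving vertices of its upset, and an upset which is a union of fibres is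
recovered from its surviving vertices, so that every cut \<open>c\<close> allowed in the definition of \<open>\<xi>\<close> prunes off exactly \<open>U\<close>.

What precedes is elementary once trees are described by their edge relation. A finite graph is a
rooted tree iff its edge relation is acyclic, gives every vertex at most one parent, and
leaves exactly one vertex without a parent (\<open>rooted_tree_iff\<close>). In these terms the components of a forest are the
fibres of the map \<open>apex\<close> sending a vertex to its first ancestor, and every subgraph of a
forest is a subforest (\<open>subforest_iff\<close>). All arguments are made for forests with at
most one root, which are the rooted trees and the empty forest; this covers the couple of empty forests.
\<close>

section \<open>Relations with unique parents\<close>

definition branching :: "'a rel \<Rightarrow> bool" where
  "branching A \<longleftrightarrow> finite A \<and> single_valued (A\<inverse>) \<and> acyclic A"

lemma branching_subset: "branching A \<Longrightarrow> B \<subseteq> A \<Longrightarrow> branching B"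
  unfolding branching_def
  by (meson acyclic_subset converse_mono finite_subset single_valued_subset)

lemma branching_parent: "branching A \<Longrightarrow> (u, v) \<in> A \<Longrightarrow> (u', v) \<in> A \<Longrightarrow> u = u'"
  unfolding branching_def single_valued_def by blast

lemma branching_no_cycle: "branching A \<Longrightarrow> (v, v) \<notin> A\<^sup>+"
  unfolding branching_def acyclic_def by blast

lemma branching_arc_no_return: "branching A \<Longrightarrow> (u, v) \<in> A \<Longrightarrow> (v, u) \<notin> A\<^sup>*"
  by (meson branching_no_cycle rtrancl_into_trancl2)

lemma branching_ancestors_comparable:
  assumes "branching A" "(x, v) \<in> A\<^sup>*" "(y, v) \<in> A\<^sup>*"
  shows "(x, y) \<in> A\<^sup>* \<or> (y, x) \<in> A\<^sup>*"
proof -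
  have "(v, x) \<in> (A\<inverse>)\<^sup>*" "(v, y) \<in> (A\<inverse>)\<^sup>*" "single_valued (A\<inverse>)"
    using assms by (auto simp: rtrancl_converse branching_def)
  from single_valued_confluent[OF this(3,1,2)] show ?thesis by (auto simp: rtrancl_converse)
qed

lemma rtrancl_parent:
  assumes "branching A" "(x, v) \<in> A\<^sup>*" "(u, v) \<in> A"
  shows "x = v \<or> (x, u) \<in> A\<^sup>*"
  using assms by (metis branching_parent rtranclE)

lemma rtrancl_root: "(u, v) \<in> A\<^sup>* \<Longrightarrow> v \<notin> Range A \<Longrightarrow> u = v"
  by (metis RangeI rtranclE)

lemma rtrancl_closed: "(u, v) \<in> A\<^sup>* \<Longrightarrow> u \<in> U \<Longrightarrow> A `` U \<subseteq> U \<Longrightarrow> v \<in> U"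
  by (induction rule: rtrancl_induct) auto

lemma finite_ancestors: "finite A \<Longrightarrow> finite {u. (u, v) \<in> A\<^sup>*}"
proof (rule finite_subset)
  show "{u. (u, v) \<in> A\<^sup>*} \<subseteq> insert v (Domain A)" by (auto elim: converse_rtranclE)
qed (simp add: finite_Domain)

text \<open>
The first ancestor of \<open>v\<close> along \<open>B\<close>. For \<open>B\<close> the edge set of a forest this is the root of the
component of \<open>v\<close>, and \<open>v\<close> itself if \<open>v\<close> does not lie in the forest; so the map contracting the forest depends on its edges alone.
\<close>

definition apex :: "'a rel \<Rightarrow> 'a \<Rightarrow> 'a" where
  "apex B v = (THE u. (u, v) \<in> B\<^sup>* \<and> u \<notin> Range B)"

lemma apex_eqI:
  assumes "branching B" "(u, v) \<in> B\<^sup>*" "u \<notin> Range B"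
  shows "apex B v = u"
  unfolding apex_def
proof (rule the_equality)
  fix u' assume "(u', v) \<in> B\<^sup>* \<and> u' \<notin> Range B"
  then show "u' = u"
    using branching_ancestors_comparable[OF assms(1), of u v u'] assms by (metis rtrancl_root)
qed (use assms in auto)

lemma apex:
  assumes "branching B"
  shows apex_reaches: "(apex B v, v) \<in> B\<^sup>*" and apex_root: "apex B v \<notin> Range B"
proof -
  have "wf B" using assms by (simp add: branching_def finite_acyclic_wf)
  then have "\<exists>u. (u, v) \<in> B\<^sup>* \<and> u \<notin> Range B"
  proof (induction v rule: wf_induct_rule)
    case (less v)
    show ?case
    proof (cases "v \<in> Range B")
      case True
      then obtain w where "(w, v) \<in> B" by blast
      with less show ?thesis by (meson rtrancl.rtrancl_into_rtrancl)
    qed auto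
  qed
  then obtain u where "(u, v) \<in> B\<^sup>*" "u \<notin> Range B" by blast
  then show "(apex B v, v) \<in> B\<^sup>*" "apex B v \<notin> Range B" using apex_eqI[OF assms] by auto
qed

lemma apex_id: "branching B \<Longrightarrow> v \<notin> Range B \<Longrightarrow> apex B v = v"
  by (rule apex_eqI) auto

lemma apex_rtrancl: "branching B \<Longrightarrow> (u, v) \<in> B\<^sup>* \<Longrightarrow> apex B u = apex B v"
  by (metis apex_eqI apex_reaches apex_root rtrancl_trans)

lemma apex_arc: "branching B \<Longrightarrow> (u, v) \<in> B \<Longrightarrow> apex B u = apex B v"
  by (rule apex_rtrancl) auto

section \<open>Forests and rooted trees\<close>

definition is_forest :: "'a graph \<Rightarrow> bool" where
  "is_forest t \<longleftrightarrow> finite (pverts t) \<and> parcs t \<subseteq> pverts t \<times> pverts t \<and> branching (parcs t)"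

abbreviation roots :: "'a graph \<Rightarrow> 'a set" where
  "roots t \<equiv> pverts t - Range (parcs t)"

text \<open>
At most one root rather than exactly one, in order to include the empty forest.
\<close>

definition single_rooted :: "'a graph \<Rightarrow> bool" where
  "single_rooted t \<longleftrightarrow> is_forest t \<and> (\<exists>r. roots t \<subseteq> {r})"

lemma is_forestD:
  assumes "is_forest t"
  shows is_forest_branching: "branching (parcs t)" and is_forest_finite: "finite (pverts t)"
    and is_forest_finite_arcs: "finite (parcs t)"
    and is_forest_arcs: "parcs t \<subseteq> pverts t \<times> pverts t"
  using assms by (auto simp: is_forest_def branching_def)

lemma is_forest_wf: "is_forest t \<Longrightarrow> wf_digraph (with_proj t)"
  unfolding wf_digraph_wp_iff by unfold_locales (auto simp: is_forest_def)

lemma apex_in_forest: "is_forest t \<Longrightarrow> v \<in> pverts t \<Longrightarrow> apex (parcs t) v \<in> roots t"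
  using apex[of "parcs t" v] is_forestD[of t] by (auto elim: converse_rtranclE)

lemma is_root_iff_roots:
  assumes "is_forest t"
  shows "is_root t r \<longleftrightarrow> roots t = {r}"
proof -
  have fin: "finite (in_arcs (with_proj t) v)" for v
    using is_forest_finite_arcs[OF assms] by (auto simp: in_arcs_def)
  have 0: "in_degree (with_proj t) v = 0 \<longleftrightarrow> v \<notin> Range (parcs t)" for v
    using fin[of v] by (auto simp: in_degree_def in_arcs_def)
  have 1: "in_degree (with_proj t) v = 1 \<longleftrightarrow> v \<in> Range (parcs t)" for v
  proof
    assume "v \<in> Range (parcs t)"
    then obtain u where "(u, v) \<in> parcs t" by blast
    then have "in_arcs (with_proj t) v = {(u, v)}"
      using branching_parent[OF is_forest_branching[OF assms]] by (auto simp: in_arcs_def)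
    then show "in_degree (with_proj t) v = 1" by (simp add: in_degree_def)
  qed (use 0[of v] in auto)
  show ?thesis unfolding is_root_def 0 1 using is_forest_arcs[OF assms] by blast
qed

text \<open>
Connectedness is exploited in this form: whatever is preserved along edges in both directions is constant.
\<close>

lemma connected_invariant:
  assumes "Digraph_Component.connected (with_proj t)"
    and "\<And>u v. (u, v) \<in> parcs t \<Longrightarrow> P u = P v" and "u \<in> pverts t" "v \<in> pverts t"
  shows "P u = P v"
proof -
  let ?S = "mk_symmetric (with_proj t)"
  have "u \<rightarrow>\<^sup>*\<^bsub>with_proj ?S\<^esub> v"
    using assms(1,3,4) by (auto simp: connected_def strongly_connected_def)
  then have "(u, v) \<in> (parcs ?S)\<^sup>*" using reachable_rtranclI by fastforce
  then show ?thesis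
    by (induction rule: rtrancl_induct) (auto simp: parcs_mk_symmetric dest: assms(2))
qed

text \<open>
The map \<open>apex\<close> is constant along edges and fixes the roots, so a connected forest has only one root; conversely
every vertex is joined to its apex.
\<close>

lemma connected_forest_iff:
  assumes "is_forest t"
  shows "Digraph_Component.connected (with_proj t) \<longleftrightarrow> (\<exists>r. roots t = {r})"
proof
  assume con: "Digraph_Component.connected (with_proj t)"
  note br = is_forest_branching[OF assms]
  obtain v where v: "v \<in> pverts t" using con by (auto simp: connected_def strongly_connected_def)
  have "u = apex (parcs t) v" if "u \<in> roots t" for u
    using connected_invariant[OF con, of "apex (parcs t)" u v] apex_arc[OF br] apex_id[OF br, of u] that v
    by auto
  then show "\<exists>r. roots t = {r}" using apex_in_forest[OF assms v] by blast
next
  assume "\<exists>r. roots t = {r}"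
  then obtain r where r: "roots t = {r}" by blast
  let ?S = "mk_symmetric (with_proj t)"
  interpret S: pair_wf_digraph ?S
    using is_forest_arcs[OF assms] by unfold_locales (auto simp: parcs_mk_symmetric)
  have reach: "u \<rightarrow>\<^sup>*\<^bsub>with_proj ?S\<^esub> v" if "u \<in> pverts t" "v \<in> pverts t" for u v
  proof -
    have *: "(r, x) \<in> (parcs t)\<^sup>*" if "x \<in> pverts t" for x
      using apex_in_forest[OF assms that] apex_reaches[OF is_forest_branching[OF assms]] r
      by (metis singletonD)
    have "parcs t \<subseteq> parcs ?S" "(parcs t)\<inverse> \<subseteq> parcs ?S" by (auto simp: parcs_mk_symmetric)
    then have "(r, v) \<in> (parcs ?S)\<^sup>*" "(u, r) \<in> (parcs ?S)\<^sup>*"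
      using *[OF that(1)] *[OF that(2)] rtrancl_mono by (blast intro: rtrancl_converseI)+
    then have "(u, v) \<in> (parcs ?S)\<^sup>*" by (meson rtrancl_trans)
    then show ?thesis using that by (simp add: S.reachable_conv)
  qed
  moreover have "pverts t \<noteq> {}" using r by blast
  ultimately show "Digraph_Component.connected (with_proj t)"
    by (simp add: connected_def strongly_connected_def)
qed

lemma pcas_nth:
  "pcas u p v \<Longrightarrow> p \<noteq> [] \<Longrightarrow> fst (p ! 0) = u \<and> snd (p ! (length p - 1)) = v
     \<and> (\<forall>i. Suc i < length p \<longrightarrow> snd (p ! i) = fst (p ! Suc i))"
proof (induction p arbitrary: u)
  case (Cons e p)
  show ?case
  proof (cases "p = []")
    case False
    with Cons have IH: "fst (p ! 0) = snd e" "snd (p ! (length p - 1)) = v"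
      "\<forall>i. Suc i < length p \<longrightarrow> snd (p ! i) = fst (p ! Suc i)" by auto
    have "snd ((e # p) ! i) = fst ((e # p) ! Suc i)" if "Suc i < length (e # p)" for i
      using that IH by (cases i) auto
    with Cons.prems IH False show ?thesis by (auto simp: nth_Cons')
  qed (use Cons in auto)
qed simp

lemma pawalk_verts_pcas: "pcas u p v \<Longrightarrow> pawalk_verts u p = u # map snd p"
  by (induction p arbitrary: u) auto

text \<open>
On a cycle of the underlying undirected graph, consider a vertex with the largest number of ancestors. Neither of its two
neighbours can be its child, so both are its parent, hence equal; but the vertices of a cycle of length at
least 3 are distinct.
\<close>

lemma forest_simply_connected:
  assumes "is_forest t"
  shows "simply_connected t"
  unfolding simply_connected_def
proof (intro allI impI, rule ccontr)
  fix p assume cyc: "pre_digraph.cycle (with_proj (mk_symmetric (with_proj t))) p" and "\<not> length p \<le> 2"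
  then have n3: "length p \<ge> 3" by simp
  define A where "A = parcs t"
  note br = is_forest_branching[OF assms, folded A_def]
  then have fin: "finite A" by (simp add: branching_def)
  define n where "n = length p"
  have sym: "parcs (mk_symmetric (with_proj t)) = A \<union> A\<inverse>"
    by (auto simp: parcs_mk_symmetric A_def)
  from cyc obtain x where x: "set p \<subseteq> A \<union> A\<inverse>" "pcas x p x" "distinct (tl (pawalk_verts x p))" "p \<noteq> []"
    by (auto simp: pre_digraph.cycle_def pre_digraph.awalk_def cas_with_proj_eq
        awalk_verts_with_proj_eq sym)
  note nth = pcas_nth[OF x(2,4)]
  have "tl (pawalk_verts x p) = map snd p"
    using pawalk_verts_pcas[OF x(2)] by simp
  with x have dist: "distinct (map snd p)" by simp
  \<comment> \<open>The cycle as a periodic sequence of vertices, so that neighbours need no case distinction at the ends.\<close>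
  define s where "s i = snd (p ! (i mod n))" for i
  have n: "n \<ge> 3" using n3 by (simp add: n_def)
  have step: "fst (p ! (Suc i mod n)) = s i" for i
  proof (cases "Suc (i mod n) = n")
    case True
    then have "Suc i mod n = 0" "i mod n = n - 1" by (simp_all add: mod_Suc)
    then show ?thesis using nth by (simp add: s_def n_def)
  next
    case False
    then have "Suc i mod n = Suc (i mod n)" by (simp add: mod_Suc)
    moreover have "Suc (i mod n) < n" using False n by (metis Suc_lessI mod_less_divisor not_numeral_le_zero neq0_conv)
    ultimately show ?thesis using nth by (simp add: s_def n_def)
  qed
  have arc: "(s i, s (Suc i)) \<in> A \<union> A\<inverse>" for i
  proof -
    have "Suc i mod n < n" using n by simp
    then have "p ! (Suc i mod n) \<in> A \<union> A\<inverse>" using x(1) nth_mem unfolding n_def by blast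
    moreover have "p ! (Suc i mod n) = (s i, s (Suc i))"
      using step[of i] by (simp add: s_def prod_eq_iff)
    ultimately show ?thesis by simp
  qed
  define depth where "depth v = card {u. (u, v) \<in> A\<^sup>*}" for v
  have depth: "depth u < depth v" if "(u, v) \<in> A" for u v
    unfolding depth_def
  proof (rule psubset_card_mono[OF finite_ancestors[OF fin]])
    show "{w. (w, u) \<in> A\<^sup>*} \<subset> {w. (w, v) \<in> A\<^sup>*}"
      using that branching_arc_no_return[OF br that] by (auto intro: rtrancl_into_rtrancl)
  qed
  have "finite ((\<lambda>i. depth (s i)) ` {..<n})" "(\<lambda>i. depth (s i)) ` {..<n} \<noteq> {}"
    using n by (auto simp: lessThan_empty_iff)
  from Max_in[OF this] obtain m where m: "m < n" "depth (s m) = Max ((\<lambda>i. depth (s i)) ` {..<n})"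
    by auto
  have max: "depth (s j) \<le> depth (s m)" for j
  proof -
    have "depth (s j) = depth (s (j mod n))" by (simp add: s_def)
    moreover have "j mod n < n" using n by simp
    ultimately show ?thesis using m by (auto intro!: Max_ge)
  qed
  \<comment> \<open>The predecessor of the deepest vertex, shifted by one period to avoid the index \<open>- 1\<close>.\<close>
  define k where "k = m + n - 1"
  have k: "Suc k = m + n" using n by (simp add: k_def)
  have sm: "s (Suc k) = s m" by (simp add: k s_def)
  have "(s k, s m) \<in> A" using arc[of k] depth max[of k] sm by (metis UnE converseD leD)
  moreover have "(s (Suc (Suc k)), s m) \<in> A"
    using arc[of "Suc k"] depth max[of "Suc (Suc k)"] sm by (metis UnE converseD leD)
  ultimately have "s k = s (Suc (Suc k))" using branching_parent[OF br] by blast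
  moreover have "k mod n < n" "Suc (Suc k) mod n < n" using n by auto
  ultimately have "k mod n = Suc (Suc k) mod n"
    using dist by (simp add: s_def n_def distinct_conv_nth) metis
  then have "n dvd Suc (Suc k) - k" using mod_eq_dvd_iff_nat[of k "Suc (Suc k)" n] by simp
  then show False using n by (auto dest: dvd_imp_le)
qed

text \<open>
Reachability from the root is preserved along edges in both directions: a vertex other than the root has only one
incoming edge, so a path reaching it passes through its parent.
\<close>

lemma rooted_tree_reachable:
  assumes "rooted_tree t" "is_root t r" "v \<in> pverts t"
  shows "(r, v) \<in> (parcs t)\<^sup>*"
proof -
  interpret pair_digraph t using assms by (simp add: rooted_tree_def)
  have fin: "finite (in_arcs (with_proj t) w)" for w by blast
  have r: "r \<in> pverts t" "\<And>u. (u, r) \<notin> parcs t"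
    using assms(2) fin[of r] by (auto simp: is_root_def in_degree_def in_arcs_def)
  have inv: "(r, u) \<in> (parcs t)\<^sup>* \<longleftrightarrow> (r, w) \<in> (parcs t)\<^sup>*" if uw: "(u, w) \<in> parcs t" for u w
  proof
    assume rw: "(r, w) \<in> (parcs t)\<^sup>*"
    have "w \<noteq> r" using r uw by blast
    then obtain u' where u': "(r, u') \<in> (parcs t)\<^sup>*" "(u', w) \<in> parcs t"
      using rw by (metis rtranclE)
    have "w \<in> pverts t" using uw in_arcsD2 by blast
    then have "card (in_arcs (with_proj t) w) = 1"
      using assms(2) \<open>w \<noteq> r\<close> by (simp add: is_root_def in_degree_def)
    moreover have "(u, w) \<in> in_arcs (with_proj t) w" "(u', w) \<in> in_arcs (with_proj t) w"
      using uw u' by (auto simp: in_arcs_def)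
    ultimately have "u = u'" by (metis card_1_singletonE prod.inject singletonD)
    then show "(r, u) \<in> (parcs t)\<^sup>*" using u' by simp
  qed (use uw in auto)
  have "Digraph_Component.connected (with_proj t)"
    using assms(1) by (simp add: rooted_tree_def)
  from connected_invariant[where P = "\<lambda>v. (r, v) \<in> (parcs t)\<^sup>*", OF this inv r(1) assms(3)]
  have "((r, r) \<in> (parcs t)\<^sup>*) = ((r, v) \<in> (parcs t)\<^sup>*)" .
  then show ?thesis by simp
qed

text \<open>
Acyclicity comes from reachability: a directed cycle through \<open>v\<close> enters \<open>v\<close> from its only parent, so it passes through the parent
as well, and inductively through the root, which has no incoming edge.
\<close>

lemma rooted_tree_is_forest:
  assumes "rooted_tree t"
  shows "is_forest t"
proof -
  interpret pair_digraph t using assms by (simp add: rooted_tree_def)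
  obtain r where root: "is_root t r" using assms by (auto simp: rooted_tree_def)
  have "u = u'" if "(u, v) \<in> parcs t" "(u', v) \<in> parcs t" for u u' v
  proof -
    have in_v: "(u, v) \<in> in_arcs (with_proj t) v" "(u', v) \<in> in_arcs (with_proj t) v"
      using that by (auto simp: in_arcs_def)
    have fin: "finite (in_arcs (with_proj t) v)" by (rule finite_in_arcs)
    have "v \<in> pverts t" using that in_arcsD2 by blast
    then have "card (in_arcs (with_proj t) v) = 1"
      using root in_v fin by (cases "v = r") (fastforce simp: is_root_def in_degree_def)+
    then show ?thesis using in_v by (metis card_1_singletonE prod.inject singletonD)
  qed
  then have sv: "single_valued ((parcs t)\<inverse>)" by (auto simp: single_valued_def)
  have acyc: "(v, v) \<notin> (parcs t)\<^sup>+" if "(r, v) \<in> (parcs t)\<^sup>*" for v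
    using that
  proof (induction rule: rtrancl_induct)
    case base
    have "finite (in_arcs (with_proj t) r)" by blast
    then have "r \<notin> Range (parcs t)"
      using root by (auto simp: is_root_def in_degree_def in_arcs_def)
    then show ?case by (metis RangeI tranclE)
  next
    case (step u v)
    show ?case
    proof
      assume "(v, v) \<in> (parcs t)\<^sup>+"
      then obtain u' where "(v, u') \<in> (parcs t)\<^sup>*" "(u', v) \<in> parcs t" by (meson tranclD2)
      then have "(v, u) \<in> (parcs t)\<^sup>*" using sv step by (auto simp: single_valued_def)
      then show False using step by (meson rtrancl_into_trancl2)
    qed
  qed
  have "acyclic (parcs t)"
    unfolding acyclic_def
  proof (intro allI notI)
    fix v assume *: "(v, v) \<in> (parcs t)\<^sup>+"
    then have "v \<in> pverts t" by (meson tranclD in_arcsD1)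
    then show False using acyc[OF rooted_tree_reachable[OF assms root]] * by blast
  qed
  then show ?thesis using sv in_arcsD1 in_arcsD2 by (auto simp: is_forest_def branching_def)
qed

lemma rooted_tree_iff: "rooted_tree t \<longleftrightarrow> is_forest t \<and> (\<exists>r. roots t = {r})"
proof
  assume *: "rooted_tree t"
  then have f: "is_forest t" by (rule rooted_tree_is_forest)
  moreover have "\<exists>r. is_root t r" using * by (simp add: rooted_tree_def)
  ultimately show "is_forest t \<and> (\<exists>r. roots t = {r})"
    unfolding is_root_iff_roots[OF f] by (rule conjI)
next
  assume *: "is_forest t \<and> (\<exists>r. roots t = {r})"
  then have f: "is_forest t" by blast
  have no_return: "(v, u) \<notin> (parcs t)\<^sup>*" if "(u, v) \<in> parcs t" for u v
    using branching_arc_no_return[OF is_forest_branching[OF f] that] .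
  have "pair_digraph t"
    using is_forestD[OF f] no_return[of v v for v] by unfold_locales fastforce+
  moreover have "\<forall>(u, v) \<in> parcs t. (v, u) \<notin> parcs t" using no_return by blast
  ultimately show "rooted_tree t"
    unfolding rooted_tree_def connected_forest_iff[OF f] is_root_iff_roots[OF f]
    using * forest_simply_connected[OF f] by blast
qed

lemma is_forest_empty [simp]: "is_forest \<one>\<^sub>F"
  by (simp add: is_forest_def empty_forest_def branching_def single_valued_def acyclic_def)

lemma single_rooted_iff: "single_rooted t \<longleftrightarrow> rooted_tree t \<or> t = \<one>\<^sub>F"
proof
  assume t: "single_rooted t"
  show "rooted_tree t \<or> t = \<one>\<^sub>F"
  proof (cases "pverts t = {}")
    case True
    then have "t = \<one>\<^sub>F" using t
      by (auto simp: single_rooted_def is_forest_def empty_forest_def intro: pair_pre_digraph.equality)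
    then show ?thesis ..
  next
    case False
    then have "roots t \<noteq> {}" using t apex_in_forest by (fastforce simp: single_rooted_def)
    then show ?thesis using t by (auto simp: single_rooted_def rooted_tree_iff)
  qed
qed (auto simp: rooted_tree_iff single_rooted_def, auto simp: empty_forest_def)

section \<open>Subforests, components and contraction\<close>

lemma induced_simps [simp]:
  "pverts (induced t W) = W"
  "parcs (induced t W) = {e \<in> parcs t. fst e \<in> W \<and> snd e \<in> W}"
  by (simp_all add: induced_def)

lemma graph_Union_simps [simp]:
  "pverts (graph_Union T) = (\<Union>t\<in>T. pverts t)"
  "parcs (graph_Union T) = (\<Union>t\<in>T. parcs t)"
  by (simp_all add: graph_Union_def)

lemma graph_eqI: "pverts s = pverts t \<Longrightarrow> parcs s = parcs t \<Longrightarrow> s = (t :: 'a graph)"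
  by (rule pair_pre_digraph.equality) auto

lemma induced_all: "is_forest t \<Longrightarrow> induced t (pverts t) = t"
  using is_forest_arcs by (intro graph_eqI) fastforce+

lemma induced_induced: "U \<subseteq> W \<Longrightarrow> induced (induced t W) U = induced t U"
  by (intro graph_eqI) auto

text \<open>
The subgraph relation in terms of the vertex and edge sets; by \<open>subforest_iff\<close> these are the subforests.
\<close>

definition subgr :: "'a graph \<Rightarrow> 'a graph \<Rightarrow> bool" where
  "subgr s t \<longleftrightarrow> pverts s \<subseteq> pverts t \<and> parcs s \<subseteq> parcs t \<and> parcs s \<subseteq> pverts s \<times> pverts s"

lemma is_forest_subgr: "is_forest t \<Longrightarrow> subgr s t \<Longrightarrow> is_forest s"
  unfolding subgr_def is_forest_def by (meson branching_subset finite_subset)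

lemma subgr_induced: "W \<subseteq> pverts t \<Longrightarrow> subgr (induced t W) t"
  by (auto simp: subgr_def)

lemma is_forest_induced: "is_forest t \<Longrightarrow> W \<subseteq> pverts t \<Longrightarrow> is_forest (induced t W)"
  using is_forest_subgr subgr_induced by blast

lemma subgraph_with_proj:
  assumes "is_forest t"
  shows "subgraph (with_proj s) (with_proj t) \<longleftrightarrow> subgr s t"
proof
  assume *: "subgraph (with_proj s) (with_proj t)"
  then interpret pair_wf_digraph s by (simp add: subgraph_def wf_digraph_wp_iff)
  show "subgr s t" using * in_arcsD1 in_arcsD2 by (auto simp: subgraph_def subgr_def)
next
  assume "subgr s t"
  then show "subgraph (with_proj s) (with_proj t)"
    using is_forest_wf[OF assms] is_forest_wf[OF is_forest_subgr[OF assms]]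
    by (auto simp: subgraph_def subgr_def compatible_def)
qed

definition tree_at :: "'a graph \<Rightarrow> 'a \<Rightarrow> 'a graph" where
  "tree_at s r = induced s {v \<in> pverts s. apex (parcs s) v = r}"

lemma tree_at_forest: "is_forest s \<Longrightarrow> is_forest (tree_at s r)"
  unfolding tree_at_def by (rule is_forest_induced) auto

lemma roots_tree_at:
  assumes "is_forest s" "r \<in> roots s"
  shows "roots (tree_at s r) = {r}"
proof -
  note br = is_forest_branching[OF assms(1)]
  have "v = r" if "v \<in> roots (tree_at s r)" for v
  proof -
    have v: "v \<in> pverts s" "apex (parcs s) v = r" using that by (auto simp: tree_at_def)
    have "v \<notin> Range (parcs s)"
    proof
      assume "v \<in> Range (parcs s)"
      then obtain u where "(u, v) \<in> parcs s" by blast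
      then have "(u, v) \<in> parcs (tree_at s r)"
        using v apex_arc[OF br] is_forest_arcs[OF assms(1)] by (auto simp: tree_at_def)
      then show False using that by blast
    qed
    then show ?thesis using v apex_id[OF br] by simp
  qed
  moreover have "r \<in> roots (tree_at s r)"
    using assms(2) apex_id[OF br, of r] by (auto simp: tree_at_def)
  ultimately show ?thesis by blast
qed

text \<open>
It follows that the fibres of \<open>apex\<close> induce the maximal connected subgraphs.
\<close>

lemma connected_subgr_tree_at:
  assumes "is_forest s" "subgr D s" "Digraph_Component.connected (with_proj D)" "v \<in> pverts D"
  shows "subgr D (tree_at s (apex (parcs s) v))"
proof -
  have "apex (parcs s) x = apex (parcs s) y" if "(x, y) \<in> parcs D" for x y
    using that assms(2) apex_arc[OF is_forest_branching[OF assms(1)]] by (auto simp: subgr_def)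
  from connected_invariant[where P = "apex (parcs s)", OF assms(3) this _ assms(4)]
  have "apex (parcs s) u = apex (parcs s) v" if "u \<in> pverts D" for u
    using that by blast
  then have "pverts D \<subseteq> pverts (tree_at s (apex (parcs s) v))"
    using assms(2) by (auto simp: tree_at_def subgr_def)
  moreover have "parcs D \<subseteq> parcs s" "parcs D \<subseteq> pverts D \<times> pverts D"
    using assms(2) by (simp_all add: subgr_def)
  ultimately show ?thesis unfolding subgr_def tree_at_def induced_simps by auto
qed

lemma components_eq:
  assumes "is_forest s"
  shows "components s = tree_at s ` roots s"
proof (intro set_eqI iffI)
  fix C assume "C \<in> components s"
  then have C: "subgr C s" "Digraph_Component.connected (with_proj C)"
    and max: "\<And>H. H \<noteq> with_proj C \<Longrightarrow> subgraph (with_proj C) H \<Longrightarrow> \<not> (subgraph H (with_proj s) \<and> Digraph_Component.connected H)"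
    by (auto simp: components_def pre_digraph.max_subgraph_def subgraph_with_proj[OF assms])
  obtain v where v: "v \<in> pverts C" using C(2) by (auto simp: connected_def strongly_connected_def)
  define r where "r = apex (parcs s) v"
  have r: "r \<in> roots s" using v C(1) apex_in_forest[OF assms] by (auto simp: r_def subgr_def)
  note fT = tree_at_forest[OF assms, of r]
  have "subgr C (tree_at s r)" unfolding r_def by (rule connected_subgr_tree_at[OF assms C v])
  then have "subgraph (with_proj C) (with_proj (tree_at s r))" by (simp add: subgraph_with_proj[OF fT])
  moreover have "subgraph (with_proj (tree_at s r)) (with_proj s)"
    unfolding subgraph_with_proj[OF assms] by (auto simp: tree_at_def subgr_def)
  moreover have "Digraph_Component.connected (with_proj (tree_at s r))"
    using roots_tree_at[OF assms r] connected_forest_iff[OF fT] by blast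
  ultimately have "with_proj (tree_at s r) = with_proj C" using max by blast
  then have "tree_at s r = C" by (auto simp: with_proj_def intro: graph_eqI)
  then show "C \<in> tree_at s ` roots s" using r by blast
next
  fix C assume "C \<in> tree_at s ` roots s"
  then obtain r where r: "r \<in> roots s" and C: "C = tree_at s r" by blast
  note fT = tree_at_forest[OF assms, of r]
  have sub: "subgr C s" by (auto simp: C tree_at_def subgr_def)
  have con: "Digraph_Component.connected (with_proj C)"
    using roots_tree_at[OF assms r] connected_forest_iff[OF fT] unfolding C by blast
  have "H = with_proj C"
    if H: "subgraph (with_proj C) H" "subgraph H (with_proj s)" "Digraph_Component.connected H" for H
  proof -
    define D where "D = \<lparr>pverts = verts H, parcs = arcs H\<rparr>"
    have HD: "H = with_proj D"
      using H(2) by (auto simp: D_def with_proj_def subgraph_def compatible_def)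
    have D: "subgr D s" "Digraph_Component.connected (with_proj D)"
      using H unfolding HD subgraph_with_proj[OF assms] by auto
    have CD: "subgr C D"
      using H(1) unfolding HD subgraph_with_proj[OF is_forest_subgr[OF assms D(1)]] .
    have "r \<in> pverts C" using r apex_id[OF is_forest_branching[OF assms]] by (auto simp: C tree_at_def)
    then have "r \<in> pverts D" using CD by (auto simp: subgr_def)
    from connected_subgr_tree_at[OF assms D this] have "subgr D C"
      using r apex_id[OF is_forest_branching[OF assms], of r] by (simp add: C)
    then have "D = C" using CD by (intro graph_eqI) (auto simp: subgr_def)
    then show ?thesis using HD by simp
  qed
  then show "C \<in> components s"
    using sub con by (auto simp: components_def pre_digraph.max_subgraph_def subgraph_with_proj[OF assms])
qed

lemma component_of:
  assumes "is_forest s" "v \<in> pverts s"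
  shows "tree_at s (apex (parcs s) v) \<in> components s" "v \<in> pverts (tree_at s (apex (parcs s) v))"
  using assms apex_in_forest[OF assms] by (auto simp: components_eq tree_at_def)

lemma component_unique:
  assumes "is_forest s" "C \<in> components s" "v \<in> pverts C"
  shows "C = tree_at s (apex (parcs s) v)" "v \<in> pverts s"
  using assms by (auto simp: components_eq tree_at_def)

lemma component:
  assumes "is_forest s" "C \<in> components s"
  shows component_forest: "is_forest C" and "\<exists>r. roots C = {r}"
    and component_subset: "pverts C \<subseteq> pverts s"
    and component_induced: "C = induced s (pverts C)"
    and component_saturated: "\<And>u v. (u, v) \<in> parcs s \<Longrightarrow> u \<in> pverts C \<longleftrightarrow> v \<in> pverts C"
proof -
  obtain r where r: "r \<in> roots s" "C = tree_at s r" using assms by (auto simp: components_eq)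
  then show "is_forest C" "\<exists>r. roots C = {r}" "pverts C \<subseteq> pverts s" "C = induced s (pverts C)"
    using tree_at_forest[OF assms(1)] roots_tree_at[OF assms(1), of r] by (auto simp: tree_at_def)
  show "u \<in> pverts C \<longleftrightarrow> v \<in> pverts C" if "(u, v) \<in> parcs s" for u v
    using that r apex_arc[OF is_forest_branching[OF assms(1)] that] is_forest_arcs[OF assms(1)]
    by (auto simp: tree_at_def)
qed

text \<open>
Prunings and trunks of a forest are defined componentwise; this glues them together again.
\<close>

lemma graph_Union_induced_components:
  assumes "is_forest s" "U \<subseteq> pverts s"
  shows "graph_Union ((\<lambda>C. induced C (pverts C \<inter> U)) ` components s) = induced s U"
proof (rule graph_eqI)
  show "pverts (graph_Union ((\<lambda>C. induced C (pverts C \<inter> U)) ` components s)) = pverts (induced s U)"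
    using component_of[OF assms(1)] assms(2) by fastforce
  show "parcs (graph_Union ((\<lambda>C. induced C (pverts C \<inter> U)) ` components s)) = parcs (induced s U)"
  proof (intro set_eqI iffI)
    fix e assume "e \<in> parcs (graph_Union ((\<lambda>C. induced C (pverts C \<inter> U)) ` components s))"
    then obtain C where "C \<in> components s" "e \<in> parcs C" "fst e \<in> U" "snd e \<in> U" by auto
    moreover from this have "e \<in> parcs s"
      using component_induced[OF assms(1)] by (metis (no_types, lifting) induced_simps(2) mem_Collect_eq)
    ultimately show "e \<in> parcs (induced s U)" by simp
  next
    fix e assume e: "e \<in> parcs (induced s U)"
    define C where "C = tree_at s (apex (parcs s) (fst e))"
    have C: "C \<in> components s" "fst e \<in> pverts C"
      unfolding C_def using component_of[OF assms(1), of "fst e"] e assms(2) by auto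
    then have "snd e \<in> pverts C" using component_saturated[OF assms(1) C(1), of "fst e" "snd e"] e by auto
    then have "e \<in> parcs (induced s (pverts C))" using C e by auto
    then have "e \<in> parcs C" using component_induced[OF assms(1) C(1)] by simp
    then show "e \<in> parcs (graph_Union ((\<lambda>C. induced C (pverts C \<inter> U)) ` components s))"
      using C e \<open>snd e \<in> pverts C\<close> by auto
  qed
qed

text \<open>
Every subgraph of a forest is a forest, and hence the disjoint union of its components, which are rooted trees.
\<close>

lemma subforest_iff:
  assumes "is_forest t"
  shows "subforest s t \<longleftrightarrow> subgr s t"
proof
  assume "subforest s t"
  then obtain T where T: "\<forall>u \<in> T. subgraph (with_proj u) (with_proj t)" "s = graph_Union T"
    by (auto simp: subforest_def)
  then have "\<forall>u \<in> T. subgr u t" by (simp add: subgraph_with_proj[OF assms])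
  then show "subgr s t" unfolding T(2) by (fastforce simp: subgr_def)
next
  assume sub: "subgr s t"
  note f = is_forest_subgr[OF assms sub]
  have "rooted_tree C \<and> subgraph (with_proj C) (with_proj t)" if "C \<in> components s" for C
  proof -
    have "subgr C s"
      using subgr_induced[OF component_subset[OF f that]] component_induced[OF f that] by simp
    then have "subgr C t" using sub by (auto simp: subgr_def)
    then show ?thesis
      using component[OF f that] by (simp add: rooted_tree_iff subgraph_with_proj[OF assms])
  qed
  moreover have "disjoint_family_on pverts (components s)"
    using component_unique(1)[OF f] unfolding disjoint_family_on_def by (metis disjoint_iff)
  moreover have "s = graph_Union (components s)"
  proof -
    have "induced C (pverts C \<inter> pverts s) = C" if "C \<in> components s" for C
      using component_subset[OF f that] induced_all[OF component_forest[OF f that]]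
      by (simp add: Int_absorb2)
    then show ?thesis
      using graph_Union_induced_components[OF f order_refl] induced_all[OF f] by simp
  qed
  ultimately show "subforest s t" unfolding subforest_def by blast
qed

lemma covering_subforest_iff:
  assumes "is_forest s"
  shows "covering_subforest s' s \<longleftrightarrow> (\<exists>B \<subseteq> parcs s. s' = \<lparr>pverts = pverts s, parcs = B\<rparr>)"
proof
  assume "covering_subforest s' s"
  then have "parcs s' \<subseteq> parcs s" "s' = \<lparr>pverts = pverts s, parcs = parcs s'\<rparr>"
    by (auto simp: covering_subforest_def subforest_iff[OF assms] subgr_def intro: graph_eqI)
  then show "\<exists>B \<subseteq> parcs s. s' = \<lparr>pverts = pverts s, parcs = B\<rparr>" by blast
qed (use is_forest_arcs[OF assms] in
    \<open>fastforce simp: covering_subforest_def subforest_iff[OF assms] subgr_def\<close>)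

lemma contract_vertex_eq_apex:
  assumes "is_forest s"
  shows "contract_vertex s v = apex (parcs s) v"
proof (cases "v \<in> pverts s")
  case True
  note root = apex_in_forest[OF assms True]
  have "(\<exists>C \<in> components s. v \<in> pverts C \<and> is_root C r) \<longleftrightarrow> r = apex (parcs s) v" for r
  proof -
    have "is_root (tree_at s (apex (parcs s) v)) r \<longleftrightarrow> r = apex (parcs s) v"
      using roots_tree_at[OF assms root] is_root_iff_roots[OF tree_at_forest[OF assms]]
      by (metis singleton_inject)
    then show ?thesis using component_of[OF assms True] component_unique[OF assms] by blast
  qed
  then show ?thesis using True by (simp add: contract_vertex_def)
next
  case False
  then have "v \<notin> Range (parcs s)" using is_forest_arcs[OF assms] by auto
  then show ?thesis
    using False apex_id[OF is_forest_branching[OF assms]] by (simp add: contract_vertex_def)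
qed

text \<open>
The explicit form of a contraction. An edge \<open>(u, v)\<close> outside \<open>B\<close> is the only edge into \<open>v\<close>, so \<open>v\<close> is the root
of its component of \<open>B\<close> and the head of the edge does not move; the surviving vertices are those without a parent in \<open>B\<close>.
\<close>

definition contract_arcs :: "'a graph \<Rightarrow> 'a rel \<Rightarrow> 'a graph" where
  "contract_arcs t B = \<lparr>pverts = pverts t - Range B, parcs = {(apex B u, v) | u v. (u, v) \<in> parcs t - B}\<rparr>"

lemma contract_arcs_simps [simp]:
  "pverts (contract_arcs t B) = pverts t - Range B"
  "parcs (contract_arcs t B) = {(apex B u, v) | u v. (u, v) \<in> parcs t - B}"
  by (simp_all add: contract_arcs_def)

lemma arc_outside_head:
  assumes "is_forest t" "B \<subseteq> parcs t" "(u, v) \<in> parcs t - B"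
  shows "v \<notin> Range B"
  using assms branching_parent[OF is_forest_branching[OF assms(1)]] by blast

lemma contract_eq:
  assumes "is_forest t" "subgr s t"
  shows "t \<oslash> s = contract_arcs t (parcs s)"
proof -
  let ?B = "parcs s"
  note f = is_forest_subgr[OF assms]
  note br = is_forest_branching[OF f]
  have cv: "contract_vertex s = apex ?B" by (rule ext, rule contract_vertex_eq_apex[OF f])
  have B: "?B \<subseteq> parcs t" using assms by (simp add: subgr_def)
  have "apex ?B v \<in> pverts t - Range ?B" if "v \<in> pverts t" for v
  proof (cases "v \<in> pverts s")
    case True
    then show ?thesis using apex_in_forest[OF f True] assms(2) by (auto simp: subgr_def)
  next
    case False
    then have "v \<notin> Range ?B" using is_forest_arcs[OF f] by auto
    then show ?thesis using that apex_id[OF br] by simp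
  qed
  moreover have "v \<in> apex ?B ` pverts t" if "v \<in> pverts t - Range ?B" for v
    using that apex_id[OF br, of v] by (metis DiffD1 DiffD2 image_eqI)
  moreover have "contract_edge s ` (parcs t - ?B) = {(apex ?B u, v) | u v. (u, v) \<in> parcs t - ?B}"
  proof -
    have "contract_edge s (u, v) = (apex ?B u, v)" if "(u, v) \<in> parcs t - ?B" for u v
      using apex_id[OF br arc_outside_head[OF assms(1) B that]] by (simp add: contract_edge_def cv)
    then show ?thesis by force
  qed
  ultimately show ?thesis by (auto simp: contract_def contract_arcs_def cv)
qed

lemma apex_reaches_in:
  "branching A \<Longrightarrow> B \<subseteq> A \<Longrightarrow> (apex B u, u) \<in> A\<^sup>*"
  by (metis apex_reaches branching_subset rtrancl_mono subsetD)

text \<open>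
A contracted edge \<open>(apex B u, v)\<close> shortcuts a path \<open>apex B u \<rightarrow> u \<rightarrow> v\<close> of the original forest. So the contracted edge relation
lies in the transitive closure of the original one and is acyclic too.
\<close>

lemma contract_arcs_forest:
  assumes "is_forest t" "B \<subseteq> parcs t"
  shows "is_forest (contract_arcs t B)" and "roots (contract_arcs t B) = roots t"
proof -
  note br = is_forest_branching[OF assms(1)]
  note brB = branching_subset[OF br assms(2)]
  have anc: "(apex B u, u) \<in> (parcs t)\<^sup>*" for u by (rule apex_reaches_in[OF br assms(2)])
  have "(parcs (contract_arcs t B)) \<subseteq> (parcs t)\<^sup>+"
    using anc by (auto intro: rtrancl_into_trancl1)
  then have "(parcs (contract_arcs t B))\<^sup>+ \<subseteq> (parcs t)\<^sup>+" by (metis trancl_mono_subset trancl_id trans_trancl)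
  then have acyc: "acyclic (parcs (contract_arcs t B))"
    using branching_no_cycle[OF br] by (auto simp: acyclic_def)
  have sv: "single_valued ((parcs (contract_arcs t B))\<inverse>)"
    using branching_parent[OF br] by (fastforce simp: single_valued_def)
  have "parcs (contract_arcs t B) = (\<lambda>(u, v). (apex B u, v)) ` (parcs t - B)" by auto
  then have fin: "finite (parcs (contract_arcs t B))" using is_forest_finite_arcs[OF assms(1)] by simp
  have "apex B u \<in> pverts t" if "u \<in> pverts t" for u
    using anc[of u] that is_forest_arcs[OF assms(1)] by (auto elim: converse_rtranclE)
  then have arcs: "parcs (contract_arcs t B) \<subseteq> pverts (contract_arcs t B) \<times> pverts (contract_arcs t B)"
    using is_forest_arcs[OF assms(1)] apex_root[OF brB] arc_outside_head[OF assms] by fastforce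
  show "is_forest (contract_arcs t B)"
    unfolding is_forest_def branching_def using arcs fin sv acyc is_forest_finite[OF assms(1)] by simp
  have "Range (parcs t) - Range B \<subseteq> Range (parcs (contract_arcs t B))" by fastforce
  moreover have "Range (parcs (contract_arcs t B)) \<subseteq> Range (parcs t)" by auto
  ultimately show "roots (contract_arcs t B) = roots t" using assms(2) by auto
qed

lemma contract_arcs_single_rooted:
  "single_rooted t \<Longrightarrow> B \<subseteq> parcs t \<Longrightarrow> single_rooted (contract_arcs t B)"
  using contract_arcs_forest unfolding single_rooted_def by metis

section \<open>Cuts as upsets\<close>

lemma pcas_append: "pcas u (p @ q) v \<longleftrightarrow> (\<exists>w. pcas u p w \<and> pcas w q v)"
  by (induction p arbitrary: u) auto

text \<open>
Parents being unique, a path from the root is determined by its end point. This removes paths from the definitions of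
admissibility and of prunings.
\<close>

lemma arcs_of_path_from_root:
  assumes "branching A" "r \<notin> Range A" "set p \<subseteq> A" "pcas r p v"
  shows "set p = {(x, y) \<in> A. (y, v) \<in> A\<^sup>*}"
  using assms(3,4)
proof (induction p arbitrary: v rule: rev_induct)
  case Nil
  then show ?case using assms(2) by (auto dest: rtrancl_root)
next
  case (snoc e p)
  then obtain u where e: "e = (u, v)" "pcas r p u" by (cases e) (auto simp: pcas_append)
  with snoc have IH: "set p = {(x, y) \<in> A. (y, u) \<in> A\<^sup>*}" and uv: "(u, v) \<in> A" by auto
  have "(y, v) \<in> A\<^sup>* \<longleftrightarrow> (y, u) \<in> A\<^sup>* \<or> y = v" for y
    using uv rtrancl_parent[OF assms(1) _ uv] by (auto intro: rtrancl_into_rtrancl)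
  moreover have "(x, v) \<in> A \<longleftrightarrow> x = u" for x using branching_parent[OF assms(1)] uv by blast
  ultimately have "{(x, y) \<in> A. (y, v) \<in> A\<^sup>*} = insert (u, v) {(x, y) \<in> A. (y, u) \<in> A\<^sup>*}"
    by blast
  then show ?case using IH e(1) by simp
qed

lemma apath_from_root:
  assumes "is_forest t" "roots t = {r}"
  shows "pre_digraph.apath (with_proj t) r p v \<Longrightarrow> set p = {(x, y) \<in> parcs t. (y, v) \<in> (parcs t)\<^sup>*}"
    and "v \<in> pverts t \<Longrightarrow> \<exists>p. pre_digraph.apath (with_proj t) r p v"
proof -
  note br = is_forest_branching[OF assms(1)]
  interpret wf_digraph "with_proj t" by (rule is_forest_wf[OF assms(1)])
  show "set p = {(x, y) \<in> parcs t. (y, v) \<in> (parcs t)\<^sup>*}" if "apath r p v"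
    using that assms(2)
    by (intro arcs_of_path_from_root[OF br, of r]) (auto simp: apath_def awalk_def cas_with_proj_eq)
  show "\<exists>p. apath r p v" if "v \<in> pverts t"
  proof -
    have "apex (parcs t) v = r" using apex_in_forest[OF assms(1) that] assms(2) by blast
    then have "(r, v) \<in> (parcs t)\<^sup>*" using apex_reaches[OF br, of v] by simp
    then have "r \<rightarrow>\<^sup>*\<^bsub>with_proj t\<^esub> v" using that assms(2) by (auto simp: reachable_conv)
    then show ?thesis by (simp add: reachable_apath)
  qed
qed

(* Prunings are evaluated by tree_pruning_Edges, which does not mention paths. *)
declare tree_pruning.simps(2) [simp del]

text \<open>
The vertex sets of prunings: sets of vertices closed under going up, away from the roots.
\<close>

definition upsets :: "'a graph \<Rightarrow> 'a set set" where
  "upsets t = {U. U \<subseteq> pverts t \<and> parcs t `` U \<subseteq> U}"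

lemma upsetsD: "U \<in> upsets t \<Longrightarrow> (u, v) \<in> parcs t \<Longrightarrow> u \<in> U \<Longrightarrow> v \<in> U"
  by (auto simp: upsets_def)

lemma upsets_subset: "U \<in> upsets t \<Longrightarrow> U \<subseteq> pverts t"
  by (auto simp: upsets_def)

lemma upsets_rtrancl: "U \<in> upsets t \<Longrightarrow> (u, v) \<in> (parcs t)\<^sup>* \<Longrightarrow> u \<in> U \<Longrightarrow> v \<in> U"
  by (auto simp: upsets_def elim: rtrancl_closed)

lemma vertices_above_edges_upset:
  assumes "is_forest t" "c \<subseteq> parcs t"
  shows "(parcs t)\<^sup>* `` snd ` c \<in> upsets t"
proof -
  have "(parcs t)\<^sup>* `` snd ` c \<subseteq> pverts t"
  proof
    fix v assume "v \<in> (parcs t)\<^sup>* `` snd ` c"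
    then obtain x y where "(x, y) \<in> c" "(y, v) \<in> (parcs t)\<^sup>*" by force
    then show "v \<in> pverts t" using assms(2) is_forest_arcs[OF assms(1)]
      by (auto intro: rtrancl_closed[of y v _ "pverts t"])
  qed
  then show ?thesis by (auto simp: upsets_def intro: rtrancl_into_rtrancl)
qed

lemma tree_pruning_Edges:
  assumes "single_rooted t" "c \<subseteq> parcs t"
  shows "tree_pruning (Edges c) t = induced t ((parcs t)\<^sup>* `` snd ` c)"
proof -
  have f: "is_forest t" using assms(1) by (simp add: single_rooted_def)
  have sub: "(parcs t)\<^sup>* `` snd ` c \<subseteq> pverts t"
    by (rule upsets_subset[OF vertices_above_edges_upset[OF f assms(2)]])
  have "(\<exists>r p. is_root t r \<and> pre_digraph.apath (with_proj t) r p v \<and> set p \<inter> c \<noteq> {})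
      \<longleftrightarrow> v \<in> (parcs t)\<^sup>* `` snd ` c" if v: "v \<in> pverts t" for v
  proof -
    obtain r where r: "roots t = {r}"
      using assms(1) apex_in_forest[OF f v] by (auto simp: single_rooted_def)
    have root: "is_root t r' \<longleftrightarrow> r' = r" for r' using is_root_iff_roots[OF f] r by auto
    define P where "P = {(x, y) \<in> parcs t. (y, v) \<in> (parcs t)\<^sup>*}"
    have P: "set p = P" if "pre_digraph.apath (with_proj t) r p v" for p
      unfolding P_def by (rule apath_from_root(1)[OF f r that])
    obtain q where "pre_digraph.apath (with_proj t) r q v" using apath_from_root(2)[OF f r v] by blast
    then have "(\<exists>r p. is_root t r \<and> pre_digraph.apath (with_proj t) r p v \<and> set p \<inter> c \<noteq> {})
        \<longleftrightarrow> P \<inter> c \<noteq> {}"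
      unfolding root using P by auto
    also have "\<dots> \<longleftrightarrow> v \<in> (parcs t)\<^sup>* `` snd ` c" unfolding P_def using assms(2) by force
    finally show ?thesis .
  qed
  then have "{v \<in> pverts t. \<exists>r p. is_root t r \<and> pre_digraph.apath (with_proj t) r p v \<and> set p \<inter> c \<noteq> {}}
      = {v \<in> pverts t. v \<in> (parcs t)\<^sup>* `` snd ` c}"
    by (rule Collect_cong[OF conj_cong[OF refl]])
  also have "\<dots> = (parcs t)\<^sup>* `` snd ` c" using sub by blast
  finally show ?thesis by (simp add: tree_pruning.simps(2))
qed

text \<open>
Admissibility means that no edge of the cut lies above another one. If \<open>(x', y')\<close> lies above \<open>(x, y)\<close>, a path through both extends to a
leaf; conversely two edges on the same path are comparable.
\<close>

lemma tree_cuts_Edges: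
  assumes "single_rooted t"
  shows "Edges c \<in> tree_cuts t \<longleftrightarrow>
    c \<subseteq> parcs t \<and> (\<forall>(x, y) \<in> c. \<forall>(x', y') \<in> c. (y, x') \<notin> (parcs t)\<^sup>*)"
    (is "_ \<longleftrightarrow> ?sub \<and> ?anti")
proof -
  have f: "is_forest t" using assms(1) by (simp add: single_rooted_def)
  note br = is_forest_branching[OF f]
  define path where "path l = {(x, y) \<in> parcs t. (y, l) \<in> (parcs t)\<^sup>*}" for l
  have leaf: "is_leaf t l \<longleftrightarrow> l \<in> pverts t \<and> l \<notin> Domain (parcs t)" for l
  proof -
    have "finite (out_arcs (with_proj t) l)"
      using is_forest_finite_arcs[OF f] by (auto simp: out_arcs_def)
    then show ?thesis by (auto simp: is_leaf_def out_degree_def out_arcs_def)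
  qed
  have cut: "(\<forall>r l p. is_root t r \<and> is_leaf t l \<and> pre_digraph.apath (with_proj t) r p l
      \<longrightarrow> card (set p \<inter> c) \<le> 1) \<longleftrightarrow> (\<forall>l. is_leaf t l \<longrightarrow> card (path l \<inter> c) \<le> 1)"
  proof (cases "roots t = {}")
    case True
    then have "pverts t = {}" using apex_in_forest[OF f] by blast
    then show ?thesis by (simp add: leaf)
  next
    case False
    then obtain r where r: "roots t = {r}" using assms(1) by (auto simp: single_rooted_def)
    have root: "is_root t r' \<longleftrightarrow> r' = r" for r' using is_root_iff_roots[OF f] r by auto
    have "card (set p \<inter> c) \<le> 1" if "\<forall>l. is_leaf t l \<longrightarrow> card (path l \<inter> c) \<le> 1"
      "is_leaf t l" "pre_digraph.apath (with_proj t) r p l" for l p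
      using that apath_from_root(1)[OF f r that(3)] by (simp add: path_def)
    moreover have "card (path l \<inter> c) \<le> 1" if *: "\<forall>r l p. is_root t r \<and> is_leaf t l
        \<and> pre_digraph.apath (with_proj t) r p l \<longrightarrow> card (set p \<inter> c) \<le> 1" and l: "is_leaf t l" for l
    proof -
      obtain p where p: "pre_digraph.apath (with_proj t) r p l"
        using apath_from_root(2)[OF f r, of l] l leaf by blast
      then show ?thesis
        using l * apath_from_root(1)[OF f r p] root[of r] unfolding path_def by metis
    qed
    ultimately show ?thesis
    proof (intro iffI allI impI, goal_cases)
      case (2 r' l p)
      then have "r' = r" using root by simp
      with 2 show ?case by blast
    qed
  qed
  have "(\<forall>l. is_leaf t l \<longrightarrow> card (path l \<inter> c) \<le> 1) \<longleftrightarrow> ?anti" if c: ?sub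
  proof
    assume *: "\<forall>l. is_leaf t l \<longrightarrow> card (path l \<inter> c) \<le> 1"
    show ?anti
    proof (clarify)
      fix x y x' y' assume xy: "(x, y) \<in> c" and xy': "(x', y') \<in> c" and yx': "(y, x') \<in> (parcs t)\<^sup>*"
      have wf: "wf ((parcs t)\<inverse>)"
        using br by (simp add: branching_def finite_acyclic_wf_converse)
      have "\<exists>l. (v, l) \<in> (parcs t)\<^sup>* \<and> l \<notin> Domain (parcs t)" for v
        using wf
      proof (induction v rule: wf_induct_rule)
        case (less v)
        show ?case
        proof (cases "v \<in> Domain (parcs t)")
          case True
          then obtain w where "(v, w) \<in> parcs t" by blast
          with less show ?thesis by (meson converse_rtrancl_into_rtrancl converseI)
        qed auto
      qed
      then obtain l where l: "(y', l) \<in> (parcs t)\<^sup>*" "l \<notin> Domain (parcs t)" by blast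
      have arcs: "(x, y) \<in> parcs t" "(x', y') \<in> parcs t" using xy xy' c by auto
      have "l \<in> pverts t"
        using l(1) arcs is_forest_arcs[OF f] by (auto intro: rtrancl_closed[of y' l _ "pverts t"])
      then have "card (path l \<inter> c) \<le> 1" using * l leaf by blast
      moreover have "(y, l) \<in> (parcs t)\<^sup>*" using yx' arcs l(1) by (meson converse_rtrancl_into_rtrancl rtrancl_trans)
      then have "{(x, y), (x', y')} \<subseteq> path l \<inter> c" using xy xy' arcs l(1) by (auto simp: path_def)
      moreover have "finite (path l \<inter> c)" using is_forest_finite_arcs[OF f] c finite_subset by blast
      ultimately have "card {(x, y), (x', y')} \<le> 1" by (meson card_mono le_trans)
      then have "(x, y) = (x', y')" by (auto simp: card_insert_if split: if_splits)
      then show False using branching_arc_no_return[OF br arcs(1)] yx' by simp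
    qed
  next
    assume anti: ?anti
    show "\<forall>l. is_leaf t l \<longrightarrow> card (path l \<inter> c) \<le> 1"
    proof (intro allI impI)
      fix l
      have "e = e'" if "e \<in> path l \<inter> c" "e' \<in> path l \<inter> c" for e e'
      proof -
        obtain x y x' y' where e: "e = (x, y)" "e' = (x', y')" by fastforce
        have arcs: "(x, y) \<in> parcs t" "(x', y') \<in> parcs t" "(x, y) \<in> c" "(x', y') \<in> c"
          using that by (auto simp: e path_def)
        have "(y, y') \<in> (parcs t)\<^sup>* \<or> (y', y) \<in> (parcs t)\<^sup>*"
          using that branching_ancestors_comparable[OF br] by (auto simp: e path_def)
        then have "y = y'"
          using rtrancl_parent[OF br _ arcs(1)] rtrancl_parent[OF br _ arcs(2)] anti arcs(3,4) by blast
        then show ?thesis using branching_parent[OF br] arcs e by blast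
      qed
      moreover have "finite (path l \<inter> c)" using is_forest_finite_arcs[OF f] c finite_subset by blast
      ultimately show "card (path l \<inter> c) \<le> 1" by (simp add: card_le_Suc0_iff_eq)
    qed
  qed
  then have "?sub \<and> (\<forall>l. is_leaf t l \<longrightarrow> card (path l \<inter> c) \<le> 1) \<longleftrightarrow> ?sub \<and> ?anti"
    by blast
  then show ?thesis unfolding tree_cuts_def cut[symmetric] by blast
qed

text \<open>
An admissible cut is recovered from its pruning as the set of edges entering it: the edge of the cut below a vertex \<open>y\<close> of the pruning
either ends in \<open>y\<close> or lies below the parent of \<open>y\<close>.
\<close>

lemma cut_is_boundary:
  assumes "single_rooted t" "Edges c \<in> tree_cuts t"
  defines "U \<equiv> pverts (tree_pruning (Edges c) t)"
  shows "c = {(x, y) \<in> parcs t. x \<notin> U \<and> y \<in> U}"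
proof -
  have br: "branching (parcs t)" using assms(1) by (simp add: single_rooted_def is_forest_def)
  have c: "c \<subseteq> parcs t" and anti: "\<And>x y x' y'. (x, y) \<in> c \<Longrightarrow> (x', y') \<in> c \<Longrightarrow> (y, x') \<notin> (parcs t)\<^sup>*"
    using assms(2) unfolding tree_cuts_Edges[OF assms(1)] by blast+
  have U: "v \<in> U \<longleftrightarrow> (\<exists>x y. (x, y) \<in> c \<and> (y, v) \<in> (parcs t)\<^sup>*)" for v
    unfolding U_def tree_pruning_Edges[OF assms(1) c] by force
  show ?thesis
  proof (intro set_eqI iffI; clarify)
    fix x y assume xy: "(x, y) \<in> c"
    then show "(x, y) \<in> parcs t \<and> x \<notin> U \<and> y \<in> U" using c U anti by blast
  next
    fix x y assume xy: "(x, y) \<in> parcs t" "x \<notin> U" "y \<in> U"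
    then obtain x' y' where c': "(x', y') \<in> c" "(y', y) \<in> (parcs t)\<^sup>*" using U by blast
    then have "y' = y" using rtrancl_parent[OF br c'(2) xy(1)] xy(2) U by blast
    then show "(x, y) \<in> c" using c' c branching_parent[OF br xy(1)] by blast
  qed
qed

lemma tree_pruning_upset:
  assumes "single_rooted t" "c \<in> tree_cuts t"
  shows "pverts (tree_pruning c t) \<in> upsets t"
    and "tree_pruning c t = induced t (pverts (tree_pruning c t))"
proof -
  have f: "is_forest t" using assms(1) by (simp add: single_rooted_def)
  have "pverts (tree_pruning c t) \<in> upsets t \<and> tree_pruning c t = induced t (pverts (tree_pruning c t))"
  proof (cases c)
    case Total
    then show ?thesis using is_forest_arcs[OF f] induced_all[OF f] by (auto simp: upsets_def)
  next
    case (Edges d)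
    have d: "d \<subseteq> parcs t" using assms(2) unfolding Edges tree_cuts_Edges[OF assms(1)] by blast
    have "(parcs t)\<^sup>* `` snd ` d \<in> upsets t" by (rule vertices_above_edges_upset[OF f d])
    then show ?thesis unfolding Edges tree_pruning_Edges[OF assms(1) d] by simp
  qed
  then show "pverts (tree_pruning c t) \<in> upsets t"
    "tree_pruning c t = induced t (pverts (tree_pruning c t))" by blast+
qed

text \<open>
An upset containing the root is everything and comes from the total cut. Otherwise the path from the root to a vertex
of the upset enters it through one of the boundary edges.
\<close>

lemma upset_is_pruning:
  assumes "single_rooted t" "U \<in> upsets t"
  shows "\<exists>c \<in> tree_cuts t. pverts (tree_pruning c t) = U"
proof -
  have f: "is_forest t" using assms(1) by (simp add: single_rooted_def)
  note br = is_forest_branching[OF f]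
  show ?thesis
  proof (cases "U = pverts t")
    case True
    then show ?thesis by (auto simp: tree_cuts_def intro: bexI[of _ Total])
  next
    case False
    define c where "c = {(x, y) \<in> parcs t. x \<notin> U \<and> y \<in> U}"
    have c: "c \<subseteq> parcs t" by (auto simp: c_def)
    have "Edges c \<in> tree_cuts t"
      unfolding tree_cuts_Edges[OF assms(1)] using upsets_rtrancl[OF assms(2)] by (auto simp: c_def)
    moreover have "(parcs t)\<^sup>* `` snd ` c = U"
    proof (intro set_eqI iffI)
      fix v assume "v \<in> U"
      have "apex (parcs t) v \<in> roots t"
        using apex_in_forest[OF f] upsets_subset[OF assms(2)] \<open>v \<in> U\<close> by blast
      then have "\<exists>r. roots t = {r}" using assms(1) unfolding single_rooted_def by blast
      then obtain r where r: "roots t = {r}" ..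
      have reach: "(r, u) \<in> (parcs t)\<^sup>*" if "u \<in> pverts t" for u
        using apex_in_forest[OF f that] apex_reaches[OF br, of u] r by auto
      have "r \<notin> U"
        using upsets_rtrancl[OF assms(2) reach] upsets_subset[OF assms(2)] False by blast
      have "(r, v) \<in> (parcs t)\<^sup>*" using reach \<open>v \<in> U\<close> upsets_subset[OF assms(2)] by blast
      then have "v \<in> U \<longrightarrow> v \<in> (parcs t)\<^sup>* `` snd ` c"
      proof (induction rule: rtrancl_induct)
        case (step u v)
        show ?case
        proof (cases "u \<in> U")
          case False
          then show ?thesis using step(2) by (force simp: c_def)
        qed (use step in \<open>auto intro: rtrancl_into_rtrancl\<close>)
      qed (use \<open>r \<notin> U\<close> in blast)
      then show "v \<in> (parcs t)\<^sup>* `` snd ` c" using \<open>v \<in> U\<close> by blast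
    qed (use upsets_rtrancl[OF assms(2)] in \<open>auto simp: c_def\<close>)
    then have "pverts (tree_pruning (Edges c) t) = U" unfolding tree_pruning_Edges[OF assms(1) c] by simp
    ultimately show ?thesis by blast
  qed
qed

text \<open>
In the empty tree the total and the empty cut have the same pruning. In a nonempty one only the total cut prunes off the root,
and the other cuts are the boundaries of their prunings.
\<close>

lemma pruning_determines_cut:
  assumes "single_rooted t" "pverts t \<noteq> {}"
  shows "inj_on (\<lambda>c. pverts (tree_pruning c t)) (tree_cuts t)"
proof -
  have f: "is_forest t" using assms(1) by (simp add: single_rooted_def)
  obtain r where r: "r \<in> roots t" using assms(2) apex_in_forest[OF f] by blast
  have proper: "r \<notin> pverts (tree_pruning (Edges c) t)" if "Edges c \<in> tree_cuts t" for c
  proof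
    assume *: "r \<in> pverts (tree_pruning (Edges c) t)"
    have c: "c \<subseteq> parcs t" using that unfolding tree_cuts_Edges[OF assms(1)] by blast
    from * obtain x y where "(x, y) \<in> c" "(y, r) \<in> (parcs t)\<^sup>*"
      unfolding tree_pruning_Edges[OF assms(1) c] by auto
    then show False using r c rtrancl_root[of y r "parcs t"] by blast
  qed
  show ?thesis
  proof (rule inj_onI)
    fix c d assume cd: "c \<in> tree_cuts t" "d \<in> tree_cuts t"
      and eq: "pverts (tree_pruning c t) = pverts (tree_pruning d t)"
    show "c = d"
    proof (cases c; cases d)
      fix x y assume "c = Edges x" "d = Edges y"
      then show ?thesis using cut_is_boundary[OF assms(1), of x] cut_is_boundary[OF assms(1), of y] cd eq by metis
    qed (use cd eq r proper in auto)
  qed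
qed

text \<open>
For a forest the upsets are the unions of upsets of its components, so the bijection for trees carries over. Components are nonempty, so that
cuts are unambiguous.
\<close>

lemma Adm_upsets:
  assumes "is_forest s"
  shows "bij_betw (\<lambda>c. pverts (pruning c s)) (Adm s) (upsets s)"
    and "c \<in> Adm s \<Longrightarrow> pruning c s = induced s (pverts (pruning c s))"
    and "c \<in> Adm s \<Longrightarrow> trunk c s = induced s (pverts s - pverts (pruning c s))"
proof -
  have sr: "single_rooted C" and ne: "pverts C \<noteq> {}" if "C \<in> components s" for C
    using component[OF assms that] by (auto simp: single_rooted_def)
  have cutC: "c C \<in> tree_cuts C" if "c \<in> Adm s" "C \<in> components s" for c C
    using that by (auto simp: Adm_def)
  have sub: "pverts (pruning c s) \<subseteq> pverts s" if "c \<in> Adm s" for c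
    using tree_pruning_upset(1)[OF sr cutC[OF that]] component_subset[OF assms]
    by (fastforce simp: pruning_def upsets_def)
  have part: "pverts C \<inter> pverts (pruning c s) = pverts (tree_pruning (c C) C)"
    if "c \<in> Adm s" "C \<in> components s" for c C
  proof -
    have le: "pverts (tree_pruning (c D) D) \<subseteq> pverts D" if "D \<in> components s" for D
      using upsets_subset[OF tree_pruning_upset(1)[OF sr[OF that] cutC[OF \<open>c \<in> Adm s\<close> that]]] .
    have "D = C" if "D \<in> components s" "v \<in> pverts D" "v \<in> pverts C" for D v
      using component_unique(1)[OF assms] that \<open>C \<in> components s\<close> by metis
    then have "pverts C \<inter> pverts (tree_pruning (c D) D) \<subseteq> pverts (tree_pruning (c C) C)"
      if "D \<in> components s" for D
      using le[OF that] that by blast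
    then show ?thesis using le[OF that(2)] that(2) unfolding pruning_def by auto
  qed
  show pruning: "pruning c s = induced s (pverts (pruning c s))" if "c \<in> Adm s" for c
  proof -
    have piece: "tree_pruning (c C) C = induced C (pverts C \<inter> pverts (pruning c s))"
      if "C \<in> components s" for C
      unfolding part[OF \<open>c \<in> Adm s\<close> that]
      by (rule tree_pruning_upset(2)[OF sr[OF that] cutC[OF \<open>c \<in> Adm s\<close> that]])
    have "pruning c s = graph_Union ((\<lambda>C. induced C (pverts C \<inter> pverts (pruning c s))) ` components s)"
      by (subst (1) pruning_def) (intro arg_cong[of _ _ graph_Union] image_cong refl piece)
    then show ?thesis unfolding graph_Union_induced_components[OF assms sub[OF that]] .
  qed
  show "trunk c s = induced s (pverts s - pverts (pruning c s))" if "c \<in> Adm s" for c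
  proof -
    have piece: "tree_trunk (c C) C = induced C (pverts C \<inter> (pverts s - pverts (pruning c s)))"
      if "C \<in> components s" for C
      using part[OF \<open>c \<in> Adm s\<close> that] component_subset[OF assms that]
      by (auto simp: tree_trunk_def trunk_of_def intro!: arg_cong[of _ _ "induced C"])
    have "trunk c s = graph_Union ((\<lambda>C. induced C (pverts C \<inter> (pverts s - pverts (pruning c s)))) ` components s)"
      unfolding trunk_def by (intro arg_cong[of _ _ graph_Union] image_cong refl piece)
    then show ?thesis by (simp add: graph_Union_induced_components[OF assms])
  qed
  show "bij_betw (\<lambda>c. pverts (pruning c s)) (Adm s) (upsets s)"
  proof (rule bij_betwI')
    fix c d assume cd: "c \<in> Adm s" "d \<in> Adm s"
    show "(pverts (pruning c s) = pverts (pruning d s)) = (c = d)"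
    proof
      assume eq: "pverts (pruning c s) = pverts (pruning d s)"
      have "c C = d C" if "C \<in> components s" for C
        using inj_onD[OF pruning_determines_cut[OF sr[OF that] ne[OF that]]] cutC[OF _ that] cd
          part[OF _ that] eq by metis
      then show "c = d" using cd unfolding Adm_def by (rule_tac PiE_ext) auto
    qed simp
  next
    fix c assume c: "c \<in> Adm s"
    have "v \<in> pverts (pruning c s)" if "(u, v) \<in> parcs s" "u \<in> pverts (pruning c s)" for u v
    proof -
      define C where "C = tree_at s (apex (parcs s) u)"
      have C: "C \<in> components s" "u \<in> pverts C"
        unfolding C_def using component_of[OF assms, of u] sub[OF c] that by auto
      have v: "v \<in> pverts C" using component_saturated[OF assms C(1) that(1)] C(2) by simp
      then have "(u, v) \<in> parcs (induced s (pverts C))" using C that by simp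
      then have "(u, v) \<in> parcs C" using component_induced[OF assms C(1)] by simp
      then have "v \<in> pverts (tree_pruning (c C) C)"
        using upsetsD[OF tree_pruning_upset(1)[OF sr[OF C(1)] cutC[OF c C(1)]]] part[OF c C(1)] C that by blast
      then show ?thesis using part[OF c C(1)] by blast
    qed
    then show "pverts (pruning c s) \<in> upsets s" using sub[OF c] by (auto simp: upsets_def)
  next
    fix U assume U: "U \<in> upsets s"
    have "\<exists>d \<in> tree_cuts C. pverts (tree_pruning d C) = pverts C \<inter> U" if "C \<in> components s" for C
    proof (rule upset_is_pruning[OF sr[OF that]])
      have "parcs C \<subseteq> parcs s" using component_induced[OF assms that]
        by (metis (no_types, lifting) induced_simps(2) mem_Collect_eq subsetI)
      then show "pverts C \<inter> U \<in> upsets C"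
        using is_forest_arcs[OF component_forest[OF assms that]] upsetsD[OF U]
        unfolding upsets_def by blast
    qed
    then obtain d where d: "\<And>C. C \<in> components s \<Longrightarrow> d C \<in> tree_cuts C \<and> pverts (tree_pruning (d C) C) = pverts C \<inter> U"
      by metis
    define c where "c = restrict d (components s)"
    have c: "c \<in> Adm s" using d by (auto simp: c_def Adm_def)
    have "pverts (pruning c s) = U"
    proof (rule set_eqI)
      fix v
      show "v \<in> pverts (pruning c s) \<longleftrightarrow> v \<in> U"
      proof (cases "v \<in> pverts s")
        case True
        note C = component_of[OF assms True]
        show ?thesis using part[OF c C(1)] d[OF C(1)] C by (auto simp: c_def)
      next
        case False
        then show ?thesis using sub[OF c] upsets_subset[OF U] by blast
      qed
    qed
    then show "\<exists>c \<in> Adm s. U = pverts (pruning c s)" using c by blast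
  qed
qed

section \<open>Cutting and contracting\<close>

text \<open>
\<open>X\<close> is a union of components of \<open>B\<close>, that is, of fibres of the map contracting \<open>B\<close>.
\<close>

definition saturated :: "'a rel \<Rightarrow> 'a set \<Rightarrow> bool" where
  "saturated B X \<longleftrightarrow> (\<forall>(x, y) \<in> B. x \<in> X \<longleftrightarrow> y \<in> X)"

lemma saturatedD: "saturated B X \<Longrightarrow> (x, y) \<in> B \<Longrightarrow> x \<in> X \<longleftrightarrow> y \<in> X"
  by (auto simp: saturated_def)

lemma saturated_rtrancl: "(x, y) \<in> B\<^sup>* \<Longrightarrow> saturated B X \<Longrightarrow> x \<in> X \<longleftrightarrow> y \<in> X"
  by (induction rule: rtrancl_induct) (auto dest: saturatedD)

lemma apex_saturated: "branching B \<Longrightarrow> saturated B X \<Longrightarrow> apex B v \<in> X \<longleftrightarrow> v \<in> X"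
  using saturated_rtrancl apex_reaches by fast

lemma apex_restrict:
  assumes "branching B" "saturated B X" "u \<in> X"
  shows "apex (B \<inter> X \<times> X) u = apex B u"
proof (rule apex_eqI)
  show "branching (B \<inter> X \<times> X)" using branching_subset[OF assms(1)] by blast
  have "(a, u) \<in> (B \<inter> X \<times> X)\<^sup>* \<and> a \<in> X" if "(a, u) \<in> B\<^sup>*" for a
    using that
  proof (induction rule: converse_rtrancl_induct)
    case (step a b)
    then have "(a, b) \<in> B \<inter> X \<times> X" using saturatedD[OF assms(2)] by blast
    then show ?case using step by (auto intro: converse_rtrancl_into_rtrancl)
  qed (use assms(3) in simp)
  then show "(apex B u, u) \<in> (B \<inter> X \<times> X)\<^sup>*" using apex_reaches[OF assms(1)] by blast
  show "apex B u \<notin> Range (B \<inter> X \<times> X)" using apex_root[OF assms(1)] by blast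
qed

text \<open>
Contraction commutes with restriction to a union of fibres, since the ancestors of a vertex of \<open>X\<close> along \<open>B\<close> stay in \<open>X\<close>. The proof
of the theorem rests on this lemma for pruned sets as well as for their complements.
\<close>

lemma contract_arcs_induced:
  assumes "is_forest t" "B \<subseteq> parcs t" "saturated B X"
  shows "contract_arcs (induced t X) (B \<inter> X \<times> X) = induced (contract_arcs t B) (X - Range B)"
proof (rule graph_eqI)
  note br = branching_subset[OF is_forest_branching[OF assms(1)] assms(2)]
  have "x \<in> Range (B \<inter> X \<times> X) \<longleftrightarrow> x \<in> Range B" if "x \<in> X" for x
    using that saturatedD[OF assms(3)] by blast
  then show "pverts (contract_arcs (induced t X) (B \<inter> X \<times> X)) = pverts (induced (contract_arcs t B) (X - Range B))"
    by auto
  have in_X: "apex B u \<in> X - Range B \<longleftrightarrow> u \<in> X" for u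
    using apex_saturated[OF br assms(3)] apex_root[OF br] by blast
  show "parcs (contract_arcs (induced t X) (B \<inter> X \<times> X)) = parcs (induced (contract_arcs t B) (X - Range B))"
    (is "?L = ?R")
  proof (intro set_eqI iffI)
    fix e assume "e \<in> ?L"
    then obtain u v where e: "e = (apex (B \<inter> X \<times> X) u, v)" "(u, v) \<in> parcs t - B" "u \<in> X" "v \<in> X"
      by auto
    then have "e = (apex B u, v)" using apex_restrict[OF br assms(3)] by simp
    then show "e \<in> ?R"
      using e(2-4) in_X[of u] arc_outside_head[OF assms(1,2) e(2)] by auto
  next
    fix e assume "e \<in> ?R"
    then obtain u v where e: "e = (apex B u, v)" "(u, v) \<in> parcs t - B" "apex B u \<in> X - Range B" "v \<in> X"
      by auto
    then have "u \<in> X" using in_X by simp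
    then have "e = (apex (B \<inter> X \<times> X) u, v)" using e(1) apex_restrict[OF br assms(3)] by simp
    then show "e \<in> ?L" using e(2,4) \<open>u \<in> X\<close> by auto
  qed
qed

lemma contract_upset:
  assumes "is_forest t" "B \<subseteq> parcs t" "saturated B U" "U \<in> upsets t"
  shows "U - Range B \<in> upsets (contract_arcs t B)"
proof -
  note br = branching_subset[OF is_forest_branching[OF assms(1)] assms(2)]
  have "v \<in> U - Range B" if "(u, v) \<in> parcs t - B" "apex B u \<in> U" for u v
    using that apex_saturated[OF br assms(3)] upsetsD[OF assms(4)] arc_outside_head[OF assms(1,2)] by blast
  then show ?thesis using upsets_subset[OF assms(4)] by (auto simp: upsets_def)
qed

text \<open>
The preimage of \<open>X\<close> under the contraction of \<open>B\<close>. By the lemmas that follow, it turns the upsets of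
the contraction bijectively into the saturated upsets of \<open>t\<close>, with inverse \<open>U \<mapsto> U - Range B\<close>.
\<close>

definition uncontract :: "'a graph \<Rightarrow> 'a rel \<Rightarrow> 'a set \<Rightarrow> 'a set" where
  "uncontract t B X = {v \<in> pverts t. apex B v \<in> X}"

lemma uncontract_upset:
  assumes "is_forest t" "B \<subseteq> parcs t" "X \<in> upsets (contract_arcs t B)"
  shows "uncontract t B X \<in> upsets t" "saturated B (uncontract t B X)"
    "uncontract t B X - Range B = X"
proof -
  note br = branching_subset[OF is_forest_branching[OF assms(1)] assms(2)]
  have "apex B v \<in> X" if "(u, v) \<in> parcs t" "apex B u \<in> X" for u v
  proof (cases "(u, v) \<in> B")
    case True
    then show ?thesis using that apex_arc[OF br] by metis
  next
    case False
    then have "(apex B u, v) \<in> parcs (contract_arcs t B)" using that by auto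
    then have "v \<in> X" using upsetsD[OF assms(3)] that by blast
    then show ?thesis using apex_id[OF br arc_outside_head[OF assms(1,2)]] that False by simp
  qed
  then show "uncontract t B X \<in> upsets t"
    using is_forest_arcs[OF assms(1)] by (auto simp: upsets_def uncontract_def)
  show "saturated B (uncontract t B X)"
    using assms(2) is_forest_arcs[OF assms(1)] apex_arc[OF br]
    by (fastforce simp: saturated_def uncontract_def)
  show "uncontract t B X - Range B = X"
  proof -
    have "X \<subseteq> pverts t - Range B" using upsets_subset[OF assms(3)] by simp
    then show ?thesis using apex_id[OF br] by (fastforce simp: uncontract_def)
  qed
qed

lemma uncontract_contract:
  assumes "branching B" "saturated B U" "U \<subseteq> pverts t"
  shows "uncontract t B (U - Range B) = U"
  using assms apex_saturated[OF assms(1,2)] apex_root[OF assms(1)] by (auto simp: uncontract_def)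

text \<open>
The edges of a cut avoiding \<open>s\<close> survive in \<open>t \<oslash> s\<close> with the same heads. A path of \<open>t\<close> from such a head to a surviving vertex is
contracted to a path of \<open>t \<oslash> s\<close>, and every path of \<open>t \<oslash> s\<close> arises in this way.
\<close>

lemma tree_pruning_contract:
  assumes "single_rooted t" "subgr s t" "c \<in> tree_cuts t" "avoids c s"
  shows "tree_pruning (contract_cut s c) (t \<oslash> s)
    = induced (contract_arcs t (parcs s)) (pverts (tree_pruning c t) - Range (parcs s))"
proof -
  have f: "is_forest t" using assms(1) by (simp add: single_rooted_def)
  define B where "B = parcs s"
  have B: "B \<subseteq> parcs t" using assms(2) by (simp add: B_def subgr_def)
  note br = is_forest_branching[OF f] and brB = branching_subset[OF is_forest_branching[OF f] B]
  note eq = contract_eq[OF f assms(2), folded B_def]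
  note f' = contract_arcs_forest(1)[OF f B]
  show ?thesis
  proof (cases c)
    case Total
    then show ?thesis using induced_all[OF f'] by (simp add: eq B_def[symmetric])
  next
    case (Edges d)
    have d: "d \<subseteq> parcs t - B"
      using assms(3,4) unfolding Edges tree_cuts_Edges[OF assms(1)] by (auto simp: B_def)
    define A' where "A' = parcs (contract_arcs t B)"
    have head: "y \<notin> Range B" if "(x, y) \<in> d" for x y
      using arc_outside_head[OF f B] that d by blast
    have "contract_edge s (x, y) = (apex B x, y)" if "(x, y) \<in> d" for x y
      using apex_id[OF brB head[OF that]] contract_vertex_eq_apex[OF is_forest_subgr[OF f assms(2)]]
      by (simp add: contract_edge_def B_def)
    then have c': "contract_edge s ` d \<subseteq> A'" "snd ` contract_edge s ` d = snd ` d"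
      using d by (force simp: A'_def)+
    have A'_heads: "v \<notin> Range B" if "(u, v) \<in> A'" for u v
      using that arc_outside_head[OF f B] by (auto simp: A'_def)
    have A'_sub: "A' \<subseteq> (parcs t)\<^sup>*"
    proof
      fix e assume "e \<in> A'"
      then obtain u v where "e = (apex B u, v)" "(u, v) \<in> parcs t" by (auto simp: A'_def)
      then show "e \<in> (parcs t)\<^sup>*" using apex_reaches_in[OF br B, of u] by simp
    qed
    \<comment> \<open>A contracted path expands to a path of \<open>t\<close>.\<close>
    have expand: "(y, v) \<in> (parcs t)\<^sup>* \<and> v \<notin> Range B" if "(y, v) \<in> A'\<^sup>*" "y \<notin> Range B" for y v
      using that(1)
    proof (induction rule: rtrancl_induct)
      case (step u v)
      then show ?case using A'_sub A'_heads by (meson rtrancl_trans subsetD)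
    qed (use that in simp)
    \<comment> \<open>A path of \<open>t\<close> contracts; the induction needs arbitrary end points, hence their apex.\<close>
    have shrink: "(y, apex B v) \<in> A'\<^sup>*" if "(y, v) \<in> (parcs t)\<^sup>*" "y \<notin> Range B" for y v
      using that(1)
    proof (induction rule: rtrancl_induct)
      case base
      then show ?case using apex_id[OF brB that(2)] by simp
    next
      case (step u v)
      show ?case
      proof (cases "(u, v) \<in> B")
        case True
        then show ?thesis using step apex_arc[OF brB] by simp
      next
        case False
        then have "(apex B u, v) \<in> A'" "apex B v = v"
          using step(2) apex_id[OF brB arc_outside_head[OF f B]] by (auto simp: A'_def)
        then show ?thesis using step by (metis rtrancl.rtrancl_into_rtrancl)
      qed
    qed
    have "v \<in> A'\<^sup>* `` snd ` d \<longleftrightarrow> v \<in> (parcs t)\<^sup>* `` snd ` d - Range B" for v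
    proof
      assume "v \<in> A'\<^sup>* `` snd ` d"
      then obtain x y where xy: "(x, y) \<in> d" "(y, v) \<in> A'\<^sup>*" by auto
      then have "y \<in> snd ` d" by (metis image_eqI snd_conv)
      then show "v \<in> (parcs t)\<^sup>* `` snd ` d - Range B" using expand[OF xy(2) head[OF xy(1)]] by blast
    next
      assume v: "v \<in> (parcs t)\<^sup>* `` snd ` d - Range B"
      then obtain x y where xy: "(x, y) \<in> d" "(y, v) \<in> (parcs t)\<^sup>*" by auto
      then have "y \<in> snd ` d" by (metis image_eqI snd_conv)
      moreover have "apex B v = v" using v apex_id[OF brB] by blast
      ultimately show "v \<in> A'\<^sup>* `` snd ` d" using shrink[OF xy(2) head[OF xy(1)]] by auto
    qed
    then have img: "A'\<^sup>* `` snd ` d = (parcs t)\<^sup>* `` snd ` d - Range B" by blast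
    have "tree_pruning (Edges (contract_edge s ` d)) (contract_arcs t B)
        = induced (contract_arcs t B) (A'\<^sup>* `` snd ` d)"
      using tree_pruning_Edges[OF contract_arcs_single_rooted[OF assms(1) B], of "contract_edge s ` d"] c'
      by (simp add: A'_def)
    moreover have "pverts (tree_pruning (Edges d) t) = (parcs t)\<^sup>* `` snd ` d"
      using tree_pruning_Edges[OF assms(1), of d] d by (simp add: subset_eq)
    ultimately show ?thesis by (simp add: Edges eq img B_def[symmetric])
  qed
qed

lemma avoids_iff_saturated:
  assumes "single_rooted t" "c \<in> tree_cuts t" "parcs s \<subseteq> parcs t"
  shows "avoids c s \<longleftrightarrow> saturated (parcs s) (pverts (tree_pruning c t))"
proof (cases c)
  case Total
  have "is_forest t" using assms(1) by (simp add: single_rooted_def)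
  then show ?thesis using is_forest_arcs[of t] assms(3) Total by (auto simp: saturated_def)
next
  case (Edges d)
  define U where "U = pverts (tree_pruning (Edges d) t)"
  have U: "U \<in> upsets t" using tree_pruning_upset(1)[OF assms(1,2)] by (simp add: Edges U_def)
  have d: "d = {(x, y) \<in> parcs t. x \<notin> U \<and> y \<in> U}"
    using cut_is_boundary[OF assms(1)] assms(2) unfolding Edges U_def by blast
  show ?thesis
    unfolding Edges U_def[symmetric] using assms(3) upsetsD[OF U]
    by (subst d) (fastforce simp: saturated_def)
qed

text \<open>
The upset of the cut in the definition of \<open>\<xi>\<close> is determined by the pruning of \<open>t \<oslash> (U, a)\<close>: the cut avoids \<open>a\<close>, so its upset is
saturated for \<open>a\<close> and agrees with \<open>U\<close> as soon as the surviving vertices do; this makes the graph \<open>w\<close> in the definition of \<open>\<xi>\<close> unique.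
\<close>

lemma xi_value:
  assumes "single_rooted t" "U \<in> upsets t" "U \<subseteq> W" "W \<subseteq> pverts t"
    and a: "a \<subseteq> parcs (induced t U)" and b: "b \<subseteq> parcs (induced t (W - U))"
  shows "\<xi> (basis_vector ((t, \<lparr>pverts = U, parcs = a\<rparr>),
        (induced t (pverts t - U), \<lparr>pverts = W - U, parcs = b\<rparr>),
        (contract_arcs t a, contract_arcs (induced t U) a)))
    = basis_vector ((t, \<lparr>pverts = W, parcs = a \<union> b\<rparr>),
        (contract_arcs t (a \<union> b), induced (contract_arcs t (a \<union> b)) (U - Range (a \<union> b))))"
proof -
  have f: "is_forest t" using assms(1) by (simp add: single_rooted_def)
  define s1 where "s1 = \<lparr>pverts = U, parcs = a\<rparr>"
  define s2 where "s2 = \<lparr>pverts = W - U, parcs = b\<rparr>"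
  define s where "s = \<lparr>pverts = W, parcs = a \<union> b\<rparr>"
  define w0 where "w0 = induced (contract_arcs t (a \<union> b)) (U - Range (a \<union> b))"
  have union: "graph_Union {s1, s2} = s"
    using assms(3) by (intro graph_eqI) (auto simp: s1_def s2_def s_def)
  have sub: "subgr s1 t" "subgr s t"
    using assms(3,4) a b by (force simp: subgr_def s1_def s_def)+
  have at: "a \<subseteq> parcs t" and bt: "b \<subseteq> parcs t" using a b by auto
  have sat_a: "saturated a U" and sat_b: "saturated b U"
    using a b by (fastforce simp: saturated_def)+
  note bra = branching_subset[OF is_forest_branching[OF f] at]
  have "a \<inter> U \<times> U = a" using a by fastforce
  then have v: "contract_arcs (induced t U) a = induced (contract_arcs t a) (U - Range a)"
    using contract_arcs_induced[OF f at sat_a] by simp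
  note eq = contract_eq[OF f sub(1)] contract_eq[OF f sub(2)]
  have av: "avoids c s \<longleftrightarrow> avoids c s1 \<and> avoids c s2" for c
    by (cases c) (auto simp: s_def s1_def s2_def)
  have "xi_pruning (t, s1) (induced t (pverts t - U), s2) (contract_arcs t a, contract_arcs (induced t U) a) w
      \<longleftrightarrow> w = w0" (is "?P \<longleftrightarrow> _") for w
  proof
    assume ?P
    then obtain c where c: "c \<in> tree_cuts t" "avoids c s1" "avoids c s2"
      and vc: "contract_arcs (induced t U) a = tree_pruning (contract_cut s1 c) (t \<oslash> s1)"
      and wc: "w = tree_pruning (contract_cut s c) (t \<oslash> s)"
      by (auto simp: xi_pruning_def union)
    define X where "X = pverts (tree_pruning c t)"
    have X: "X \<in> upsets t" unfolding X_def by (rule tree_pruning_upset(1)[OF assms(1) c(1)])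
    have satX: "saturated a X"
      using avoids_iff_saturated[OF assms(1) c(1), of s1] c(2) at by (simp add: X_def s1_def)
    have "induced (contract_arcs t a) (U - Range a) = induced (contract_arcs t a) (X - Range a)"
      using vc unfolding v tree_pruning_contract[OF assms(1) sub(1) c(1,2)] by (simp add: X_def s1_def)
    then have "U - Range a = X - Range a" by (metis induced_simps(1))
    then have "X = U"
      using uncontract_contract[OF bra satX upsets_subset[OF X]]
        uncontract_contract[OF bra sat_a upsets_subset[OF assms(2)]] by simp
    then show "w = w0"
      unfolding wc w0_def using tree_pruning_contract[OF assms(1) sub(2) c(1)] c av
      by (simp add: X_def s_def)
  next
    assume w: "w = w0"
    obtain c where c: "c \<in> tree_cuts t" "pverts (tree_pruning c t) = U"
      using upset_is_pruning[OF assms(1,2)] by blast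
    have avoid: "avoids c s1" "avoids c s2"
      using avoids_iff_saturated[OF assms(1) c(1)] c(2) at bt sat_a sat_b by (simp_all add: s1_def s2_def)
    have "induced t (pverts t - U) = tree_trunk c t" by (simp add: tree_trunk_def trunk_of_def c)
    moreover have "contract_arcs (induced t U) a = tree_pruning (contract_cut s1 c) (t \<oslash> s1)"
      unfolding v using tree_pruning_contract[OF assms(1) sub(1) c(1) avoid(1)] c by (simp add: s1_def)
    moreover have "w0 = tree_pruning (contract_cut s c) (t \<oslash> s)"
      unfolding w0_def using tree_pruning_contract[OF assms(1) sub(2) c(1)] av avoid c by (simp add: s_def)
    moreover have "contract_arcs t a = t \<oslash> s1" by (simp add: eq(1)) (simp add: s1_def)
    ultimately show ?P using c(1) avoid w unfolding xi_pruning_def union split by blast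
  qed
  then have "xi_pruning (t, s1) (induced t (pverts t - U), s2)
      (contract_arcs t a, contract_arcs (induced t U) a) = (\<lambda>w. w = w0)" by blast
  moreover have "t \<oslash> s = contract_arcs t (a \<union> b)" unfolding eq(2) by (simp add: s_def)
  ultimately show ?thesis
    unfolding xi_def linear_extension_basis_vector split s1_def[symmetric] s2_def[symmetric] s_def[symmetric]
      w0_def[symmetric] union
    by simp
qed

section \<open>Couples\<close>

lemma upsets_induced:
  assumes "W \<in> upsets t"
  shows "upsets (induced t W) = {U \<in> upsets t. U \<subseteq> W}"
proof (intro set_eqI iffI)
  fix U assume U: "U \<in> upsets (induced t W)"
  then have "U \<subseteq> W" by (simp add: upsets_def)
  then have "v \<in> U" if "(u, v) \<in> parcs t" "u \<in> U" for u v
    using that upsetsD[OF U, of u v] upsetsD[OF assms that(1)] by auto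
  then show "U \<in> {U \<in> upsets t. U \<subseteq> W}"
    using \<open>U \<subseteq> W\<close> upsets_subset[OF assms] by (auto simp: upsets_def)
qed (auto simp: upsets_def)

lemma upsets_trunk: "W \<in> upsets t \<Longrightarrow> W - X \<in> upsets (induced t (pverts t - X))"
  unfolding upsets_def by auto

lemma single_rooted_trunk:
  assumes "single_rooted t" "X \<in> upsets t"
  shows "single_rooted (induced t (pverts t - X))"
proof -
  have f: "is_forest t" using assms(1) by (simp add: single_rooted_def)
  have "roots (induced t (pverts t - X)) \<subseteq> roots t"
    using upsetsD[OF assms(2)] is_forest_arcs[OF f] by fastforce
  then show ?thesis
    using is_forest_induced[OF f, of "pverts t - X"] assms(1) unfolding single_rooted_def by blast
qed

lemma V_basis_iff: "(t, s) \<in> V_basis \<longleftrightarrow> single_rooted t \<and> (\<exists>U \<in> upsets t. s = induced t U)"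
proof -
  have "(\<exists>c \<in> tree_cuts t. s = tree_pruning c t) \<longleftrightarrow> (\<exists>U \<in> upsets t. s = induced t U)" if "single_rooted t"
    using tree_pruning_upset[OF that] upset_is_pruning[OF that] by metis
  moreover have "(\<exists>U \<in> upsets \<one>\<^sub>F. s = induced \<one>\<^sub>F U) \<longleftrightarrow> s = \<one>\<^sub>F"
    by (auto simp: upsets_def empty_forest_def induced_def)
  ultimately show ?thesis unfolding V_basis_def single_rooted_iff by auto
qed

lemma Vtilde_basis_iff: "(t, s) \<in> Vtilde_basis \<longleftrightarrow> single_rooted t \<and> subgr s t"
proof -
  have "subgr s \<one>\<^sub>F \<longleftrightarrow> s = \<one>\<^sub>F" by (auto simp: subgr_def empty_forest_def intro: graph_eqI)
  then show ?thesis
    using subforest_iff[OF rooted_tree_is_forest] unfolding Vtilde_basis_def single_rooted_iff by auto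
qed

section \<open>Linear algebra of formal sums\<close>

lemma linear_extension_sum:
  "linear_extension f (\<Sum>i\<in>I. g i) = (\<Sum>i\<in>I. linear_extension f (g i))"
  using module_hom.sum[of scale scale "linear_extension f" g I]
  by (simp add: module_hom_iff_linear linear_linear_extension)

lemma linear_extension_scale: "linear_extension f (scale a x) = scale a (linear_extension f x)"
  using linear_linear_extension[of f] by (simp add: Vector_Spaces.linear_iff)

lemma basis_expansion:
  "x = (\<Sum>b \<in> Poly_Mapping.keys x. scale (Poly_Mapping.lookup x b) (basis_vector b))"
  by (auto intro!: poly_mapping_eqI
      simp: lookup_sum basis_vector_def lookup_single when_def in_keys_iff if_distrib cong: if_cong)

text \<open>
The coordinates of a tensor product, from which bilinearity is read off.
\<close>

lemma lookup_tensor: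
  "Poly_Mapping.lookup (tensor x y) (b, c) = Poly_Mapping.lookup x b * Poly_Mapping.lookup y c"
proof -
  have "Poly_Mapping.lookup (tensor x y) (b, c)
      = (\<Sum>b' \<in> Poly_Mapping.keys x. if b' = b then \<Sum>c' \<in> Poly_Mapping.keys y.
          if c' = c then Poly_Mapping.lookup x b * Poly_Mapping.lookup y c else 0 else 0)"
    unfolding tensor_def lookup_sum lookup_single when_def
  proof (rule sum.cong[OF refl])
    fix b'
    show "(\<Sum>c' \<in> Poly_Mapping.keys y. if (b', c') = (b, c)
          then Poly_Mapping.lookup x b' * Poly_Mapping.lookup y c' else 0)
        = (if b' = b then \<Sum>c' \<in> Poly_Mapping.keys y.
          if c' = c then Poly_Mapping.lookup x b * Poly_Mapping.lookup y c else 0 else 0)"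
      by (cases "b' = b") (auto intro!: sum.cong)
  qed
  also have "\<dots> = Poly_Mapping.lookup x b * Poly_Mapping.lookup y c"
    by (simp add: in_keys_iff)
  finally show ?thesis .
qed

lemma tensor_sum_right: "tensor x (\<Sum>j\<in>J. g j) = (\<Sum>j\<in>J. tensor x (g j))"
  by (rule poly_mapping_eqI) (auto simp: lookup_tensor lookup_sum sum_distrib_left)

lemma tensor_sum:
  "tensor (\<Sum>i\<in>I. f i) (\<Sum>j\<in>J. g j) = (\<Sum>i\<in>I. \<Sum>j\<in>J. tensor (f i) (g j))"
  by (rule poly_mapping_eqI) (auto simp: lookup_tensor lookup_sum sum_product)

lemma tensor_map_basis_vector:
  "(f \<otimes>\<^sub>m g) (basis_vector (b, c)) = tensor (f (basis_vector b)) (g (basis_vector c))"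
  by (simp add: tensor_map_def)

lemma tensor_map_sum: "(f \<otimes>\<^sub>m g) (\<Sum>i\<in>I. h i) = (\<Sum>i\<in>I. (f \<otimes>\<^sub>m g) (h i))"
  by (simp add: tensor_map_def linear_extension_sum)

lemma space_on_sum:
  assumes "\<And>i. i \<in> I \<Longrightarrow> f i \<in> space_on B"
  shows "(\<Sum>i\<in>I. f i) \<in> space_on B"
  using assms keys_sum[of f I] unfolding space_on_def by blast

lemma space_on_scale: "x \<in> space_on B \<Longrightarrow> scale a x \<in> space_on B"
  by (auto simp: space_on_def in_keys_iff)

lemma basis_vector_in_space_on: "b \<in> B \<Longrightarrow> basis_vector b \<in> space_on B"
  by (auto simp: space_on_def basis_vector_def)

section \<open>The exchange of cuts and contractions\<close>

text \<open>
The bijection \<open>(B, X) \<leftrightarrow> (U, a, b)\<close>, with \<open>B = a \<union> b\<close>, \<open>X = U - Range B\<close> and \<open>U\<close> the preimage of \<open>X\<close>. The sets \<open>a\<close> and \<open>b\<close> are the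
parts of \<open>B\<close> inside and outside \<open>U\<close>, which exhaust \<open>B\<close> because \<open>U\<close> is saturated.
\<close>

lemma sum_contract_then_cut:
  fixes f :: "'a rel \<Rightarrow> 'a set \<Rightarrow> 'b::comm_monoid_add"
  assumes "is_forest t" "W \<in> upsets t"
  shows "(\<Sum>B \<in> Pow (parcs (induced t W)). \<Sum>X \<in> {X \<in> upsets (contract_arcs t B). X \<subseteq> W - Range B}. f B X)
    = (\<Sum>U \<in> {U \<in> upsets t. U \<subseteq> W}. \<Sum>a \<in> Pow (parcs (induced t U)).
        \<Sum>b \<in> Pow (parcs (induced t (W - U))). f (a \<union> b) (U - Range (a \<union> b)))"
proof -
  have fin: "finite (parcs (induced t X))" for X using is_forest_finite_arcs[OF assms(1)] by simp
  have fin_up: "finite (upsets u)" if "finite (pverts u)" for u :: "'a graph"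
    by (rule finite_subset[of _ "Pow (pverts u)"]) (use that in \<open>auto simp: upsets_def\<close>)
  have finV: "finite (pverts t)" by (rule is_forest_finite[OF assms(1)])
  let ?S = "SIGMA B : Pow (parcs (induced t W)). {X \<in> upsets (contract_arcs t B). X \<subseteq> W - Range B}"
  let ?T = "SIGMA U : {U \<in> upsets t. U \<subseteq> W}. Pow (parcs (induced t U)) \<times> Pow (parcs (induced t (W - U)))"
  have sat: "saturated (a \<union> b) U" if "a \<subseteq> parcs (induced t U)" "b \<subseteq> parcs (induced t (W - U))" for U a b
    using that by (fastforce simp: saturated_def)
  have sub: "B \<subseteq> parcs t" if "B \<subseteq> parcs (induced t X)" for B X using that by auto
  have decomp: "B = (B \<inter> U \<times> U) \<union> (B \<inter> (W - U) \<times> (W - U))"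
    if "B \<subseteq> parcs (induced t W)" "saturated B U" for B U
    using that unfolding saturated_def by fastforce
  have parts: "(a \<union> b) \<inter> U \<times> U = a" "(a \<union> b) \<inter> (W - U) \<times> (W - U) = b"
    if "a \<subseteq> parcs (induced t U)" "b \<subseteq> parcs (induced t (W - U))" for U a b
    using that by fastforce+
  have X: "uncontract t B X \<in> upsets t" "saturated B (uncontract t B X)"
    "uncontract t B X - Range B = X" "uncontract t B X \<subseteq> W"
    if "B \<subseteq> parcs (induced t W)" "X \<in> upsets (contract_arcs t B)" "X \<subseteq> W - Range B" for B X
  proof -
    note u = uncontract_upset[OF assms(1) sub[OF that(1)] that(2)]
    show "uncontract t B X \<in> upsets t" "saturated B (uncontract t B X)"
      "uncontract t B X - Range B = X" by (fact u)+
    have "Range B \<subseteq> W" using that(1) by auto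
    then show "uncontract t B X \<subseteq> W" using u(3) that(3) by blast
  qed
  have U: "a \<union> b \<subseteq> parcs (induced t W)" "U - Range (a \<union> b) \<in> upsets (contract_arcs t (a \<union> b))"
    "uncontract t (a \<union> b) (U - Range (a \<union> b)) = U"
    if "U \<in> upsets t" "U \<subseteq> W" "a \<subseteq> parcs (induced t U)" "b \<subseteq> parcs (induced t (W - U))" for U a b
  proof -
    show 1: "a \<union> b \<subseteq> parcs (induced t W)" using that(2-4) by auto
    note s = sat[OF that(3,4)]
    show "U - Range (a \<union> b) \<in> upsets (contract_arcs t (a \<union> b))"
      by (rule contract_upset[OF assms(1) sub[OF 1] s that(1)])
    show "uncontract t (a \<union> b) (U - Range (a \<union> b)) = U"
      by (rule uncontract_contract[OF branching_subset[OF is_forest_branching[OF assms(1)] sub[OF 1]]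
            s upsets_subset[OF that(1)]])
  qed
  have "(\<Sum>B \<in> Pow (parcs (induced t W)). \<Sum>X \<in> {X \<in> upsets (contract_arcs t B). X \<subseteq> W - Range B}. f B X)
      = (\<Sum>(B, X) \<in> ?S. f B X)"
    using fin fin_up finV by (subst sum.Sigma) auto
  also have "\<dots> = (\<Sum>(U, a, b) \<in> ?T. f (a \<union> b) (U - Range (a \<union> b)))"
  proof (rule sum.reindex_bij_witness[where
        i = "\<lambda>(U, a, b). (a \<union> b, U - Range (a \<union> b))" and
        j = "\<lambda>(B, X). let U = uncontract t B X in (U, B \<inter> U \<times> U, B \<inter> (W - U) \<times> (W - U))"])
    fix p assume "p \<in> ?S"
    then obtain B X where p: "p = (B, X)" and BX: "B \<subseteq> parcs (induced t W)"
      "X \<in> upsets (contract_arcs t B)" "X \<subseteq> W - Range B" by auto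
    define U where "U = uncontract t B X"
    note u = X[OF BX, folded U_def] and s = decomp[OF BX(1) X(2)[OF BX], folded U_def]
    show "(case case p of (B, X) \<Rightarrow> let U = uncontract t B X in (U, B \<inter> U \<times> U, B \<inter> (W - U) \<times> (W - U)) of
        (U, a, b) \<Rightarrow> (a \<union> b, U - Range (a \<union> b))) = p"
      unfolding p split Let_def U_def[symmetric] s[symmetric] u(3) ..
    show "(case p of (B, X) \<Rightarrow> let U = uncontract t B X in (U, B \<inter> U \<times> U, B \<inter> (W - U) \<times> (W - U))) \<in> ?T"
      unfolding p split Let_def U_def[symmetric] using u(1,4) BX(1) by auto
    show "(case case p of (B, X) \<Rightarrow> let U = uncontract t B X in (U, B \<inter> U \<times> U, B \<inter> (W - U) \<times> (W - U)) of
        (U, a, b) \<Rightarrow> f (a \<union> b) (U - Range (a \<union> b))) = (case p of (B, X) \<Rightarrow> f B X)"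
      unfolding p split Let_def U_def[symmetric] s[symmetric] u(3) ..
  next
    fix q assume "q \<in> ?T"
    then obtain U a b where q: "q = (U, a, b)" and ab: "U \<in> upsets t" "U \<subseteq> W"
      "a \<subseteq> parcs (induced t U)" "b \<subseteq> parcs (induced t (W - U))" by (auto simp del: induced_simps)
    show "(case case q of (U, a, b) \<Rightarrow> (a \<union> b, U - Range (a \<union> b)) of
        (B, X) \<Rightarrow> let U = uncontract t B X in (U, B \<inter> U \<times> U, B \<inter> (W - U) \<times> (W - U))) = q"
      unfolding q split Let_def U(3)[OF ab] parts[OF ab(3,4)] ..
    show "(case q of (U, a, b) \<Rightarrow> (a \<union> b, U - Range (a \<union> b))) \<in> ?S"
      unfolding q split using U(1,2)[OF ab] ab(2) by blast
  qed
  also have "\<dots> = (\<Sum>U \<in> {U \<in> upsets t. U \<subseteq> W}. \<Sum>(a, b) \<in> Pow (parcs (induced t U)) \<times> Pow (parcs (induced t (W - U))).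
      f (a \<union> b) (U - Range (a \<union> b)))"
    using fin fin_up finV by (subst sum.Sigma) (auto simp del: induced_simps)
  also have "\<dots> = (\<Sum>U \<in> {U \<in> upsets t. U \<subseteq> W}. \<Sum>a \<in> Pow (parcs (induced t U)).
        \<Sum>b \<in> Pow (parcs (induced t (W - U))). f (a \<union> b) (U - Range (a \<union> b)))"
    by (simp add: sum.cartesian_product)
  finally show ?thesis .
qed

lemma Delta_basis_vector:
  assumes "is_forest t" "W \<in> upsets t"
  shows "\<Delta> (basis_vector (t, induced t W)) = (\<Sum>U \<in> {U \<in> upsets t. U \<subseteq> W}.
    basis_vector ((t, induced t U), (induced t (pverts t - U), induced t (W - U))))"
proof -
  let ?s = "induced t W"
  let ?g = "\<lambda>U. basis_vector ((t, induced t U), (induced t (pverts t - U), induced t (W - U)))"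
  have f: "is_forest ?s" by (rule is_forest_induced[OF assms(1) upsets_subset[OF assms(2)]])
  have "\<Delta> (basis_vector (t, ?s)) = (\<Sum>c \<in> Adm ?s.
      basis_vector ((t, pruning c ?s), (trunk_of t (pruning c ?s), trunk c ?s)))"
    by (simp add: Delta_def)
  also have "\<dots> = (\<Sum>c \<in> Adm ?s. ?g (pverts (pruning c ?s)))"
  proof (rule sum.cong[OF refl])
    fix c assume c: "c \<in> Adm ?s"
    define U where "U = pverts (pruning c ?s)"
    have "U \<subseteq> W"
      using bij_betwE[OF Adm_upsets(1)[OF f]] c upsets_subset unfolding U_def by fastforce
    then have "pruning c ?s = induced t U" "trunk c ?s = induced t (W - U)"
      using Adm_upsets(2,3)[OF f c, folded U_def] by (simp_all add: induced_induced)
    then show "basis_vector ((t, pruning c ?s), (trunk_of t (pruning c ?s), trunk c ?s))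
        = ?g (pverts (pruning c ?s))"
      by (simp add: trunk_of_def)
  qed
  also have "\<dots> = (\<Sum>U \<in> upsets ?s. ?g U)" by (rule sum.reindex_bij_betw[OF Adm_upsets(1)[OF f]])
  finally show ?thesis by (simp add: upsets_induced[OF assms(2)])
qed

lemma phi_basis_vector:
  assumes "is_forest t" "subgr s t"
  shows "\<phi> (basis_vector (t, s)) = (\<Sum>B \<in> Pow (parcs s).
    basis_vector ((t, \<lparr>pverts = pverts s, parcs = B\<rparr>), (contract_arcs t B, contract_arcs s B)))"
proof -
  note f = is_forest_subgr[OF assms]
  let ?c = "\<lambda>B. \<lparr>pverts = pverts s, parcs = B\<rparr>"
  have "{s'. covering_subforest s' s} = ?c ` Pow (parcs s)"
    by (auto simp: covering_subforest_iff[OF f])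
  then have "\<phi> (basis_vector (t, s)) =
      (\<Sum>s' \<in> ?c ` Pow (parcs s). basis_vector ((t, s'), (t \<oslash> s', s \<oslash> s')))"
    by (simp add: phi_def)
  also have "\<dots> = (\<Sum>B \<in> Pow (parcs s). basis_vector ((t, ?c B), (t \<oslash> ?c B, s \<oslash> ?c B)))"
    by (simp add: sum.reindex inj_on_def)
  also have "\<dots> = (\<Sum>B \<in> Pow (parcs s). basis_vector ((t, ?c B), (contract_arcs t B, contract_arcs s B)))"
  proof (rule sum.cong[OF refl])
    fix B assume "B \<in> Pow (parcs s)"
    then have "subgr (?c B) s" using is_forest_arcs[OF f] by (auto simp: subgr_def)
    moreover from this have "subgr (?c B) t" using assms(2) by (auto simp: subgr_def)
    ultimately show "basis_vector ((t, ?c B), (t \<oslash> ?c B, s \<oslash> ?c B))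
        = basis_vector ((t, ?c B), (contract_arcs t B, contract_arcs s B))"
      by (simp add: contract_eq[OF assms(1)] contract_eq[OF f])
  qed
  finally show ?thesis .
qed

lemma contract_couple:
  assumes "is_forest t" "W \<subseteq> pverts t" "B \<subseteq> parcs (induced t W)"
  shows "contract_arcs (induced t W) B = induced (contract_arcs t B) (W - Range B)"
proof -
  have "B \<inter> W \<times> W = B" "saturated B W" using assms(3) by (fastforce simp: saturated_def)+
  then show ?thesis using contract_arcs_induced[OF assms(1), of B W] assms(3) by fastforce
qed

text \<open>
The summand on both sides, with everything expressed inside \<open>t\<close> contracted along \<open>B\<close>.
\<close>

definition contract_cut_term :: "'a graph \<Rightarrow> 'a set \<Rightarrow> 'a rel \<Rightarrow> 'a set \<Rightarrow> 'a couple \<times> 'a couple \<times> 'a couple" where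
  "contract_cut_term t W B X =
     ((t, \<lparr>pverts = W, parcs = B\<rparr>), (contract_arcs t B, induced (contract_arcs t B) X),
      (induced (contract_arcs t B) (pverts t - Range B - X), induced (contract_arcs t B) (W - Range B - X)))"

lemma Delta_after_phi:
  assumes "is_forest t" "W \<in> upsets t"
  shows "(id \<otimes>\<^sub>m \<Delta>) (\<phi> (basis_vector (t, induced t W))) =
    (\<Sum>B \<in> Pow (parcs (induced t W)). \<Sum>X \<in> {X \<in> upsets (contract_arcs t B). X \<subseteq> W - Range B}.
      basis_vector (contract_cut_term t W B X))"
proof -
  have step: "(id \<otimes>\<^sub>m \<Delta>) (basis_vector ((t, \<lparr>pverts = W, parcs = B\<rparr>), (contract_arcs t B, contract_arcs (induced t W) B)))
      = (\<Sum>X \<in> {X \<in> upsets (contract_arcs t B). X \<subseteq> W - Range B}. basis_vector (contract_cut_term t W B X))"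
    if "B \<subseteq> parcs (induced t W)" for B
  proof -
    have B: "B \<subseteq> parcs t" "saturated B W" using that by (fastforce simp: saturated_def)+
    note eq = contract_couple[OF assms(1) upsets_subset[OF assms(2)] that]
    note D = Delta_basis_vector[OF contract_arcs_forest(1)[OF assms(1) B(1)] contract_upset[OF assms(1) B assms(2)]]
    show ?thesis
      unfolding tensor_map_basis_vector eq D id_apply tensor_sum_right
      by (simp add: contract_cut_term_def)
  qed
  show ?thesis
    unfolding phi_basis_vector[OF assms(1) subgr_induced[OF upsets_subset[OF assms(2)]]]
      tensor_map_sum induced_simps(1)
    by (intro sum.cong refl step) blast
qed

text \<open>
The covering subforests of the pruning and of the trunk only contract edges inside \<open>U\<close> and inside \<open>W - U\<close>. Restricting \<open>t\<close>
contracted along \<open>a \<union> b\<close> to the complement of \<open>U\<close> therefore gives the same graph as contracting the trunk along \<open>b\<close>.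
\<close>

lemma xi_after_phi_phi:
  assumes "single_rooted t" "W \<subseteq> pverts t" "U \<in> upsets t" "U \<subseteq> W"
  shows "(assoc \<circ> (\<xi> \<otimes>\<^sub>m id) \<circ> \<tau>\<^sub>2\<^sub>3 \<circ> (\<phi> \<otimes>\<^sub>m \<phi>))
      (basis_vector ((t, induced t U), (induced t (pverts t - U), induced t (W - U)))) =
    (\<Sum>a \<in> Pow (parcs (induced t U)). \<Sum>b \<in> Pow (parcs (induced t (W - U))).
      basis_vector (contract_cut_term t W (a \<union> b) (U - Range (a \<union> b))))"
proof -
  have f: "is_forest t" using assms(1) by (simp add: single_rooted_def)
  let ?R = "induced t (pverts t - U)"
  have fR: "is_forest ?R" by (rule is_forest_induced[OF f]) auto
  have sub: "subgr (induced t U) t" "subgr (induced t (W - U)) ?R"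
    using assms by (auto simp: subgr_def)
  let ?q = "\<lambda>a b. (((t, \<lparr>pverts = U, parcs = a\<rparr>), (contract_arcs t a, contract_arcs (induced t U) a)),
      ((?R, \<lparr>pverts = W - U, parcs = b\<rparr>), (contract_arcs ?R b, contract_arcs (induced t (W - U)) b)))"
  have 1: "(\<phi> \<otimes>\<^sub>m \<phi>) (basis_vector ((t, induced t U), (?R, induced t (W - U)))) =
      (\<Sum>a \<in> Pow (parcs (induced t U)). \<Sum>b \<in> Pow (parcs (induced t (W - U))). basis_vector (?q a b))"
    unfolding tensor_map_basis_vector phi_basis_vector[OF f sub(1)] phi_basis_vector[OF fR sub(2)] tensor_sum
    by simp
  have 2: "(assoc \<circ> (\<xi> \<otimes>\<^sub>m id) \<circ> \<tau>\<^sub>2\<^sub>3) (basis_vector (?q a b)) =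
      basis_vector (contract_cut_term t W (a \<union> b) (U - Range (a \<union> b)))"
    if a: "a \<subseteq> parcs (induced t U)" and b: "b \<subseteq> parcs (induced t (W - U))" for a b
  proof -
    let ?B = "a \<union> b"
    have B: "?B \<subseteq> parcs t" using a b by auto
    have R: "contract_arcs (induced t (Y - U)) b = induced (contract_arcs t ?B) (Y - U - Range ?B)"
      if "W \<subseteq> Y" for Y
    proof -
      have "?B \<inter> (Y - U) \<times> (Y - U) = b" "saturated ?B (Y - U)"
        using a b that assms(4) by (fastforce simp: saturated_def)+
      then show ?thesis using contract_arcs_induced[OF f B, of "Y - U"] by simp
    qed
    have diff: "Y - U - Range ?B = Y - Range ?B - (U - Range ?B)" for Y by blast
    show ?thesis
      unfolding o_apply
      by (simp add: tensor_map_basis_vector xi_value[OF assms(1,3,4,2) a b] assoc_def tau23_def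
          contract_cut_term_def R[OF assms(2)] R[OF order_refl] diff del: contract_arcs_simps induced_simps)
  qed
  have "(assoc \<circ> (\<xi> \<otimes>\<^sub>m id) \<circ> \<tau>\<^sub>2\<^sub>3 \<circ> (\<phi> \<otimes>\<^sub>m \<phi>)) (basis_vector ((t, induced t U), (?R, induced t (W - U))))
      = (\<Sum>a \<in> Pow (parcs (induced t U)). \<Sum>b \<in> Pow (parcs (induced t (W - U))).
          (assoc \<circ> (\<xi> \<otimes>\<^sub>m id) \<circ> \<tau>\<^sub>2\<^sub>3) (basis_vector (?q a b)))"
    unfolding comp_apply 1 unfolding assoc_def tau23_def tensor_map_def linear_extension_sum ..
  also have "\<dots> = (\<Sum>a \<in> Pow (parcs (induced t U)). \<Sum>b \<in> Pow (parcs (induced t (W - U))).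
      basis_vector (contract_cut_term t W (a \<union> b) (U - Range (a \<union> b))))"
    by (intro sum.cong refl 2) blast+
  finally show ?thesis .
qed

lemma exchange_on_basis:
  assumes "(t, s) \<in> V_basis"
  shows "(id \<otimes>\<^sub>m \<Delta>) (\<phi> (basis_vector (t, s))) =
      (assoc \<circ> (\<xi> \<otimes>\<^sub>m id) \<circ> \<tau>\<^sub>2\<^sub>3 \<circ> (\<phi> \<otimes>\<^sub>m \<phi>)) (\<Delta> (basis_vector (t, s) :: 'a couple \<Rightarrow>\<^sub>0 'k::field))"
    and "(id \<otimes>\<^sub>m \<Delta>) (\<phi> (basis_vector (t, s) :: 'a couple \<Rightarrow>\<^sub>0 'k::field))
      \<in> space_on (Vtilde_basis \<times> V_basis \<times> V_basis)"
proof -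
  obtain W where t: "single_rooted t" and W: "W \<in> upsets t" and s: "s = induced t W"
    using assms by (auto simp: V_basis_iff)
  have f: "is_forest t" using t by (simp add: single_rooted_def)
  have "(assoc \<circ> (\<xi> \<otimes>\<^sub>m id) \<circ> \<tau>\<^sub>2\<^sub>3 \<circ> (\<phi> \<otimes>\<^sub>m \<phi>)) (\<Delta> (basis_vector (t, s) :: 'a couple \<Rightarrow>\<^sub>0 'k))
      = (\<Sum>U \<in> {U \<in> upsets t. U \<subseteq> W}. (assoc \<circ> (\<xi> \<otimes>\<^sub>m id) \<circ> \<tau>\<^sub>2\<^sub>3 \<circ> (\<phi> \<otimes>\<^sub>m \<phi>))
          (basis_vector ((t, induced t U), (induced t (pverts t - U), induced t (W - U)))))"
    unfolding s Delta_basis_vector[OF f W] comp_apply assoc_def tau23_def tensor_map_def linear_extension_sum ..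
  also have "\<dots> = (\<Sum>U \<in> {U \<in> upsets t. U \<subseteq> W}. \<Sum>a \<in> Pow (parcs (induced t U)).
      \<Sum>b \<in> Pow (parcs (induced t (W - U))).
      basis_vector (contract_cut_term t W (a \<union> b) (U - Range (a \<union> b))))"
    by (intro sum.cong refl xi_after_phi_phi[OF t upsets_subset[OF W]]) blast+
  also have "\<dots> = (id \<otimes>\<^sub>m \<Delta>) (\<phi> (basis_vector (t, s)))"
    unfolding s Delta_after_phi[OF f W] by (rule sum_contract_then_cut[OF f W, symmetric])
  finally show "(id \<otimes>\<^sub>m \<Delta>) (\<phi> (basis_vector (t, s))) =
      (assoc \<circ> (\<xi> \<otimes>\<^sub>m id) \<circ> \<tau>\<^sub>2\<^sub>3 \<circ> (\<phi> \<otimes>\<^sub>m \<phi>)) (\<Delta> (basis_vector (t, s) :: 'a couple \<Rightarrow>\<^sub>0 'k))" ..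
  have "contract_cut_term t W B X \<in> Vtilde_basis \<times> V_basis \<times> V_basis"
    if B: "B \<subseteq> parcs (induced t W)" and X: "X \<in> upsets (contract_arcs t B)" "X \<subseteq> W - Range B" for B X
  proof -
    let ?t = "contract_arcs t B"
    have BW: "B \<subseteq> parcs t" "saturated B W" using B by (fastforce simp: saturated_def)+
    note t' = contract_arcs_single_rooted[OF t BW(1)]
    have "subgr \<lparr>pverts = W, parcs = B\<rparr> t"
      using B upsets_subset[OF W] by (fastforce simp: subgr_def)
    moreover have "W - Range B - X \<in> upsets (induced ?t (pverts ?t - X))"
      by (rule upsets_trunk[OF contract_upset[OF f BW W]])
    moreover have "induced ?t (W - Range B - X) = induced (induced ?t (pverts ?t - X)) (W - Range B - X)"
      using upsets_subset[OF W] by (intro induced_induced[symmetric]) auto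
    moreover have "pverts ?t - X = pverts t - Range B - X" by simp
    ultimately show ?thesis
      using t t' X(1) single_rooted_trunk[OF t' X(1)]
      unfolding contract_cut_term_def mem_Times_iff fst_conv snd_conv V_basis_iff Vtilde_basis_iff by metis
  qed
  then show "(id \<otimes>\<^sub>m \<Delta>) (\<phi> (basis_vector (t, s) :: 'a couple \<Rightarrow>\<^sub>0 'k))
      \<in> space_on (Vtilde_basis \<times> V_basis \<times> V_basis)"
    unfolding s Delta_after_phi[OF f W]
    by (intro space_on_sum basis_vector_in_space_on) blast
qed

theorem theorem10:
  fixes x :: "'a couple \<Rightarrow>\<^sub>0 'k::field"
  assumes "x \<in> V"
  shows "((id \<otimes>\<^sub>m \<Delta>) \<circ> \<phi>) x \<in> space_on (Vtilde_basis \<times> V_basis \<times> V_basis)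
    \<and> ((id \<otimes>\<^sub>m \<Delta>) \<circ> \<phi>) x = (assoc \<circ> (\<xi> \<otimes>\<^sub>m id) \<circ> \<tau>\<^sub>2\<^sub>3 \<circ> (\<phi> \<otimes>\<^sub>m \<phi>) \<circ> \<Delta>) x"
proof -
  let ?L = "(id \<otimes>\<^sub>m \<Delta>) \<circ> \<phi> :: ('a couple \<Rightarrow>\<^sub>0 'k) \<Rightarrow> _"
  let ?R = "assoc \<circ> (\<xi> \<otimes>\<^sub>m id) \<circ> \<tau>\<^sub>2\<^sub>3 \<circ> (\<phi> \<otimes>\<^sub>m \<phi>) \<circ> \<Delta> :: ('a couple \<Rightarrow>\<^sub>0 'k) \<Rightarrow> _"
  let ?K = "Poly_Mapping.keys x" and ?c = "Poly_Mapping.lookup x"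
  have keys: "?K \<subseteq> V_basis" using assms by (simp add: V_def space_on_def)
  have "?L (\<Sum>b\<in>?K. scale (?c b) (basis_vector b)) = (\<Sum>b\<in>?K. scale (?c b) (?L (basis_vector b)))"
    unfolding comp_apply Delta_def phi_def tensor_map_def linear_extension_sum linear_extension_scale ..
  then have L: "?L x = (\<Sum>b\<in>?K. scale (?c b) (?L (basis_vector b)))"
    by (simp only: basis_expansion[symmetric])
  have "?R (\<Sum>b\<in>?K. scale (?c b) (basis_vector b)) = (\<Sum>b\<in>?K. scale (?c b) (?R (basis_vector b)))"
    unfolding comp_apply assoc_def tau23_def Delta_def tensor_map_def
      linear_extension_sum linear_extension_scale ..
  then have R: "?R x = (\<Sum>b\<in>?K. scale (?c b) (?R (basis_vector b)))"
    by (simp only: basis_expansion[symmetric])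
  have "?L (basis_vector b) = ?R (basis_vector b)"
    "?L (basis_vector b) \<in> space_on (Vtilde_basis \<times> V_basis \<times> V_basis)" if "b \<in> ?K" for b
    using exchange_on_basis[of "fst b" "snd b"] subsetD[OF keys that] by simp_all
  then show ?thesis unfolding L R by (auto intro!: space_on_sum space_on_scale sum.cong)
qed

end
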